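(* Let $v$ satisfy the standing assumptions and the doubling condition with constant $D$. Let $u\in h^\infty_v$, with $|u(z)|\le Kv(|z|)$ on $\mathbb{D}$, be represented by a Hadamard gap series $u(z)=\operatorname{Re}\sum_k a_{n_k}z^{n_k}$ ($n_k$ positive integers, $n_{k+1}\ge\lambda n_k$, $\lambda>1$). Then for almost every $\phi\in(-\pi,\pi]$, $$\limsup_{R\to1}\frac{I_u(R,\phi)}{\big(\log v(R)\,\log\log\log v(R)\big)^{1/2}}\le C,$$ where $C$ depends only on $D$, $K$ and $\lambda$, and $I_u(R,\phi)=\int_{1/2}^R\frac{u(re^{i\phi})\,dv(r)}{v(r)^2}$.
   Context: Standing assumptions: $v:[0,1)\to[1,\infty)$ is positive, increasing, continuous, $v(0)=1$, $\lim_{r\to1}v(r)=+\infty$. Doubling condition: $v(1-d)\le D\,v(1-2d)$ for all $d\in(0,1/2]$. $h^\infty_v$ is the set of real harmonic $u$ on $\mathbb{D}$ with $|u(z)|\le Kv(|z|)$ for some $K>0$. The integral defining $I_u$ is a Riemann–Stieltjes integral with respect to $v$. *)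

theory Defs
  imports "HOL-Analysis.Analysis"
begin

definition weight :: "(real \<Rightarrow> real) \<Rightarrow> bool" where
  "weight v \<longleftrightarrow> (\<forall>r\<in>{0..<1}. v r > 0) \<and> mono_on {0..<1} v \<and>
     continuous_on {0..<1} v \<and> v 0 = 1 \<and> filterlim v at_top (at_left 1)"

definition doubling :: "(real \<Rightarrow> real) \<Rightarrow> real \<Rightarrow> bool" where
  "doubling v D \<longleftrightarrow> (\<forall>d\<in>{0<..1/2}. v (1 - d) \<le> D * v (1 - 2*d))"

definition has_RS_integral ::
  "(real \<Rightarrow> real) \<Rightarrow> (real \<Rightarrow> real) \<Rightarrow> real \<Rightarrow> real \<Rightarrow> real \<Rightarrow> bool" where
  "has_RS_integral f g a b I \<longleftrightarrow>
     (\<forall>\<epsilon>>0. \<exists>\<delta>>0. \<forall>(m::nat) (x::nat \<Rightarrow> real) (t::nat \<Rightarrow> real).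
        x 0 = a \<and> x m = b \<and>
        (\<forall>i<m. x i < x (Suc i) \<and> x (Suc i) - x i < \<delta> \<and> x i \<le> t i \<and> t i \<le> x (Suc i))
        \<longrightarrow> \<bar>(\<Sum>i<m. f (t i) * (g (x (Suc i)) - g (x i))) - I\<bar> < \<epsilon>)"

definition RS_integral ::
  "(real \<Rightarrow> real) \<Rightarrow> (real \<Rightarrow> real) \<Rightarrow> real \<Rightarrow> real \<Rightarrow> real" where
  "RS_integral f g a b = (THE I. has_RS_integral f g a b I)"

definition gap_series :: "(nat \<Rightarrow> complex) \<Rightarrow> (nat \<Rightarrow> nat) \<Rightarrow> complex \<Rightarrow> real" where
  "gap_series c n z = Re (\<Sum>k. c k * z ^ n k)"

definition I_u :: "(complex \<Rightarrow> real) \<Rightarrow> (real \<Rightarrow> real) \<Rightarrow> real \<Rightarrow> real \<Rightarrow> real" where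
  "I_u u v R \<phi> = RS_integral (\<lambda>r. u (complex_of_real r * cis \<phi>) / (v r)^2) v (1/2) R"

end

theory Submission
  imports Defs
begin

text \<open>
  Substituting \<open>t = v r\<close> turns \<open>I_u\<close> into \<open>\<integral> u (w t \<sqdot> e\<^sup>i\<^sup>\<phi>) / t\<^sup>2 dt\<close> with \<open>w\<close> a right
  inverse of \<open>v\<close>; this is again a lacunary trigonometric series in \<open>\<phi>\<close>. Parseval at radius \<open>r\<close>
  gives \<open>\<Sum>\<bar>a\<^sub>k\<bar>\<^sup>2 r\<^bsup>2n\<^sub>k\<^esup> \<le> 2 K\<^sup>2 v(r)\<^sup>2\<close>, and with the doubling condition the blocks
  \<open>2 ^ m \<le> t \<le> 2 ^ (m + 1)\<close> are almost orthogonal, so that the increment over \<open>2 ^ l \<le> t \<le> 2 ^ m\<close>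
  has variance \<open>O(m - l)\<close>. Comparing \<open>exp\<close> of a lacunary sum with a Riesz product shows that the
  increments are subgaussian with this variance, and dyadic chaining together with Borel--Cantelli
  yields the law of the iterated logarithm in the number \<open>m \<approx> log v(R)\<close> of blocks.
\<close>

section \<open>Trigonometric sums and Riesz products\<close>

text \<open>The pointwise bound \<open>\<bar>u\<bar> \<le> K * v\<close> alone gives only a multiple
  of \<open>log v(R)\<close>; the square root has to come from cancellation in \<phi>. The phase of
  each term is independent of the radius, so integrating between two scales changes only the
  nonnegative amplitudes. Every increment is therefore a series with the same lacunary frequencies,
  and one tail estimate serves all pairs of scales. The obstacle is the maximum over the scales: the
  increments come with no independence or martingale structure that would supply a maximal
  inequality, and the chaining uses nothing but tails of pairs. Upper tails suffice because the
  limsup is one-sided. Uniformity of the constant: \<open>lam\<close> enters only through an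
  exponent \<open>q\<close> with \<open>lam ^ q \<ge> 2\<close>, while \<open>K\<close> and
  \<open>D\<close> enter through the variance per block. The terms that depend further on
  \<open>v\<close> stay bounded as \<open>R\<close> tends to 1 and are absorbed by the growing
  denominator.\<close>

lemma integral_cos_circle:
  fixes a :: nat and \<theta> :: real
  assumes "a > 0"
  shows "integral {-pi..pi} (\<lambda>x. cos (real a * x + \<theta>)) = 0"
proof -
  have "((\<lambda>x. cos (real a * x + \<theta>)) has_integral
      (sin (real a * pi + \<theta>) / a - sin (real a * (-pi) + \<theta>) / a)) {-pi..pi}"
    by (rule fundamental_theorem_of_calculus)
       (use assms in \<open>auto intro!: derivative_eq_intros
          simp: has_real_derivative_iff_has_vector_derivative[symmetric]\<close>)
  moreover have "sin (real a * (-pi) + \<theta>) = sin (real a * pi + \<theta>)"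
    by (simp add: sin_add sin_diff)
  ultimately show ?thesis
    by (simp add: integral_unique)
qed

lemma integral_cos_mult_cos_circle:
  fixes a b :: nat
  assumes "a > 0" "b > 0"
  shows "integral {-pi..pi} (\<lambda>x. cos (real a * x + \<theta>) * cos (real b * x + \<eta>)) =
    (if a = b then pi * cos (\<theta> - \<eta>) else 0)"
proof -
  have *: "integral {-pi..pi} (\<lambda>x. cos (real a * x + \<theta>) * cos (real b * x + \<eta>)) =
     (if a = b then pi * cos (\<theta> - \<eta>) else 0)"
    if "a \<ge> b" "b > 0" for a b :: nat and \<theta> \<eta>
  proof -
    have "integral {-pi..pi} (\<lambda>x. cos (real a * x + \<theta>) * cos (real b * x + \<eta>)) =
      integral {-pi..pi} (\<lambda>x. cos (real (a - b) * x + (\<theta> - \<eta>)) / 2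
        + cos (real (a + b) * x + (\<theta> + \<eta>)) / 2)"
    proof (rule integral_cong)
      fix x
      show "cos (real a * x + \<theta>) * cos (real b * x + \<eta>) =
        cos (real (a - b) * x + (\<theta> - \<eta>)) / 2 + cos (real (a + b) * x + (\<theta> + \<eta>)) / 2"
        using cos_times_cos[of "real a * x + \<theta>" "real b * x + \<eta>"] that
        by (simp add: of_nat_diff algebra_simps add_divide_distrib)
    qed
    also have "\<dots> = integral {-pi..pi} (\<lambda>x. cos (real (a - b) * x + (\<theta> - \<eta>))) / 2
        + integral {-pi..pi} (\<lambda>x. cos (real (a + b) * x + (\<theta> + \<eta>))) / 2"
      by (subst integral_add) (auto intro!: integrable_continuous_interval continuous_intros)
    also have "\<dots> = (if a = b then pi * cos (\<theta> - \<eta>) else 0)"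
      using that by (auto simp: integral_cos_circle simp del: of_nat_add of_nat_diff)
    finally show ?thesis .
  qed
  show ?thesis
  proof (cases "a \<ge> b")
    case False
    then show ?thesis
      using *[of a b \<eta> \<theta>] assms by (simp add: mult.commute cos_diff)
  qed (use * assms in auto)
qed

lemma integral_square_trig_poly:
  fixes n :: "nat \<Rightarrow> nat"
  assumes "strict_mono n" "n 0 > 0"
  shows "integral {-pi..pi} (\<lambda>x. (\<Sum>k<N. b k * cos (real (n k) * x + \<theta> k))\<^sup>2) = pi * (\<Sum>k<N. (b k)\<^sup>2)"
proof -
  have pos: "n k > 0" for k
    using assms strict_mono_leD[of n 0 k] by auto
  have "integral {-pi..pi} (\<lambda>x. (\<Sum>k<N. b k * cos (real (n k) * x + \<theta> k))\<^sup>2) =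
     integral {-pi..pi} (\<lambda>x. \<Sum>k<N. \<Sum>j<N. b k * b j *
       (cos (real (n k) * x + \<theta> k) * cos (real (n j) * x + \<theta> j)))"
    by (simp add: power2_eq_square sum_product mult_ac)
  also have "\<dots> = (\<Sum>k<N. \<Sum>j<N. b k * b j * integral {-pi..pi} (\<lambda>x.
       (cos (real (n k) * x + \<theta> k) * cos (real (n j) * x + \<theta> j))))"
    by (subst integral_sum | simp | intro integrable_continuous_interval continuous_intros)+
  also have "\<dots> = (\<Sum>k<N. \<Sum>j<N. if k = j then pi * (b k)\<^sup>2 else 0)"
    using assms(1) by (intro sum.cong refl)
      (auto simp: integral_cos_mult_cos_circle pos strict_mono_eq power2_eq_square)
  also have "\<dots> = pi * (\<Sum>k<N. (b k)\<^sup>2)"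
    by (simp add: sum_distrib_left)
  finally show ?thesis .
qed

text \<open>Absolute summability makes the tail uniformly small, so a long partial sum is bounded by
  \<open>G + e\<close>; Parseval for that finite sum and \<open>e\<close> tending to 0 give the
  claim. The factor 2 is the ratio of the circle length \<open>2 * pi\<close> to the integral
  \<open>pi\<close> of a squared cosine.\<close>

lemma Bessel_gap:
  fixes n :: "nat \<Rightarrow> nat"
  assumes n: "strict_mono n" "n 0 > 0"
    and b: "summable (\<lambda>k. \<bar>b k\<bar>)"
    and bound: "\<And>x. \<bar>\<Sum>k. b k * cos (real (n k) * x + \<theta> k)\<bar> \<le> G"
  shows "(\<Sum>k<N. (b k)\<^sup>2) \<le> 2 * G\<^sup>2"
proof -
  have G: "G \<ge> 0" using bound[of 0] by linarith
  have sm: "summable (\<lambda>k. b k * cos (real (n k) * x + \<theta> k))" for x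
    by (rule summable_comparison_test'[OF b, of 0]) (auto simp: abs_mult intro!: mult_left_le)
  have lim: "((\<lambda>e. 2 * (G + e)\<^sup>2) \<longlongrightarrow> 2 * (G + 0)\<^sup>2) (at_right 0)"
    by (intro tendsto_intros)
  have "(\<Sum>k<N. (b k)\<^sup>2) \<le> 2 * (G + e)\<^sup>2" if e: "e > 0" for e
  proof -
    have "(\<lambda>M. \<Sum>k. \<bar>b (k + M)\<bar>) \<longlonglongrightarrow> 0"
      using suminf_exist_split2[OF b] .
    then have "\<forall>\<^sub>F M in sequentially. (\<Sum>k. \<bar>b (k + M)\<bar>) < e"
      using e by (rule order_tendstoD(2))
    then obtain M0 where "\<And>M. M \<ge> M0 \<Longrightarrow> (\<Sum>k. \<bar>b (k + M)\<bar>) < e"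
      by (auto simp: eventually_sequentially)
    then obtain M where M: "(\<Sum>k. \<bar>b (k + M)\<bar>) < e" "M \<ge> N"
      by (meson max.cobounded1 max.cobounded2)
    have pt: "(\<Sum>k<M. b k * cos (real (n k) * x + \<theta> k))\<^sup>2 \<le> (G + e)\<^sup>2" for x
    proof -
      let ?f = "\<lambda>k. b k * cos (real (n k) * x + \<theta> k)"
      have "(\<Sum>k. ?f k) = (\<Sum>k. ?f (k + M)) + (\<Sum>k<M. ?f k)"
        by (rule suminf_split_initial_segment[OF sm])
      moreover have "\<bar>\<Sum>k. ?f (k + M)\<bar> \<le> (\<Sum>k. \<bar>b (k + M)\<bar>)"
      proof -
        have s1: "summable (\<lambda>k. \<bar>b (k + M)\<bar>)"
          using b by (subst summable_iff_shift)
        have "norm (\<Sum>k. ?f (k + M)) \<le> (\<Sum>k. norm (b (k + M)))"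
          by (rule norm_suminf_le) (use s1 in \<open>auto simp: abs_mult intro!: mult_left_le\<close>)
        then show ?thesis by simp
      qed
      ultimately have "\<bar>\<Sum>k<M. ?f k\<bar> \<le> G + e"
        using bound[of x] M by linarith
      then show ?thesis
        using power_mono[of "\<bar>\<Sum>k<M. ?f k\<bar>" "G + e" 2] by simp
    qed
    have "pi * (\<Sum>k<N. (b k)\<^sup>2) \<le> pi * (\<Sum>k<M. (b k)\<^sup>2)"
      using M by (intro mult_left_mono sum_mono2) auto
    also have "\<dots> = integral {-pi..pi} (\<lambda>x. (\<Sum>k<M. b k * cos (real (n k) * x + \<theta> k))\<^sup>2)"
      by (rule integral_square_trig_poly[OF n, symmetric])
    also have "\<dots> \<le> integral {-pi..pi} (\<lambda>x. (G + e)\<^sup>2)"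
      by (intro integral_le pt integrable_continuous_interval continuous_intros)
    also have "\<dots> = pi * (2 * (G + e)\<^sup>2)"
      by simp
    finally show ?thesis by simp
  qed
  then have "\<forall>\<^sub>F e in at_right 0. (\<Sum>k<N. (b k)\<^sup>2) \<le> 2 * (G + e)\<^sup>2"
    by (auto simp: eventually_at_filter)
  from tendsto_lowerbound[OF lim this] show ?thesis by simp
qed

text \<open>The product only contains frequencies up to \<open>\<Sum>i<N. n i < n N\<close>.\<close>
lemma integral_Riesz_product_mult_cos:
  fixes n :: "nat \<Rightarrow> nat"
  assumes "(\<Sum>i<N. n i) < a"
  shows "integral {-pi..pi} (\<lambda>x. (\<Prod>k<N. A k + B k * cos (real (n k) * x + \<theta> k))
    * cos (real a * x + \<eta>)) = 0"
  using assms
proof (induction N arbitrary: a \<eta>)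
  case 0
  then show ?case by (simp add: integral_cos_circle)
next
  case (Suc N)
  let ?P = "\<lambda>x. \<Prod>k<N. A k + B k * cos (real (n k) * x + \<theta> k)"
  have "integral {-pi..pi} (\<lambda>x. (\<Prod>k<Suc N. A k + B k * cos (real (n k) * x + \<theta> k))
      * cos (real a * x + \<eta>)) =
    integral {-pi..pi} (\<lambda>x. A N * (?P x * cos (real a * x + \<eta>)) +
      (B N / 2 * (?P x * cos (real (a - n N) * x + (\<eta> - \<theta> N))) +
       B N / 2 * (?P x * cos (real (a + n N) * x + (\<eta> + \<theta> N)))))"
  proof (rule integral_cong)
    fix x
    have "cos (real a * x + \<eta>) * cos (real (n N) * x + \<theta> N) =
      (cos (real (a - n N) * x + (\<eta> - \<theta> N)) + cos (real (a + n N) * x + (\<eta> + \<theta> N))) / 2"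
      using Suc.prems cos_times_cos[of "real a * x + \<eta>" "real (n N) * x + \<theta> N"]
      by (simp add: of_nat_diff algebra_simps)
    then show "(\<Prod>k<Suc N. A k + B k * cos (real (n k) * x + \<theta> k)) * cos (real a * x + \<eta>) =
      A N * (?P x * cos (real a * x + \<eta>)) +
      (B N / 2 * (?P x * cos (real (a - n N) * x + (\<eta> - \<theta> N))) +
       B N / 2 * (?P x * cos (real (a + n N) * x + (\<eta> + \<theta> N))))"
      unfolding prod.lessThan_Suc by algebra
  qed
  also have "\<dots> = A N * integral {-pi..pi} (\<lambda>x. ?P x * cos (real a * x + \<eta>)) +
      (B N / 2 * integral {-pi..pi} (\<lambda>x. ?P x * cos (real (a - n N) * x + (\<eta> - \<theta> N))) +
       B N / 2 * integral {-pi..pi} (\<lambda>x. ?P x * cos (real (a + n N) * x + (\<eta> + \<theta> N))))"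
    by (subst integral_add integral_mult_right | intro integrable_continuous_interval continuous_intros)+
       (rule refl)
  \<comment> \<open>The difference \<open>a - n N\<close> still exceeds the sum of the first
    \<open>N\<close> frequencies, so the induction hypothesis applies to all three frequencies and
    the subtraction on naturals is not truncated.\<close>
  also have "\<dots> = 0"
    using Suc.prems by (simp add: Suc.IH del: of_nat_add of_nat_diff)
  finally show ?case .
qed

text \<open>Each new cosine is orthogonal to the product before it, so only its constant term
  survives: in the mean the factors behave as if they were independent.\<close>

lemma integral_Riesz_product:
  fixes n :: "nat \<Rightarrow> nat"
  assumes "\<And>k. (\<Sum>i<k. n i) < n k"
  shows "integral {-pi..pi} (\<lambda>x. \<Prod>k<N. A k + B k * cos (real (n k) * x + \<theta> k)) = 2 * pi * (\<Prod>k<N. A k)"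
proof (induction N)
  case (Suc N)
  let ?P = "\<lambda>x. \<Prod>k<N. A k + B k * cos (real (n k) * x + \<theta> k)"
  have "integral {-pi..pi} (\<lambda>x. \<Prod>k<Suc N. A k + B k * cos (real (n k) * x + \<theta> k)) =
    integral {-pi..pi} (\<lambda>x. A N * ?P x + B N * (?P x * cos (real (n N) * x + \<theta> N)))"
    by (simp add: algebra_simps)
  also have "\<dots> = A N * integral {-pi..pi} ?P +
      B N * integral {-pi..pi} (\<lambda>x. ?P x * cos (real (n N) * x + \<theta> N))"
    by (subst integral_add integral_mult_right | intro integrable_continuous_interval continuous_intros)+
       (rule refl)
  finally show ?case
    using Suc assms by (simp add: integral_Riesz_product_mult_cos)
qed simp

section \<open>Subgaussian moments and tails of lacunary cosine sums\<close>

text \<open>Termwise comparison of the two power series in \<open>x\<^sup>2\<close>, whose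
  coefficients are \<open>1 / (2m)!\<close> and \<open>1 / (2 ^ m * m!)\<close>.\<close>

lemma cosh_le_exp_half_square: "cosh (x::real) \<le> exp (x\<^sup>2 / 2)"
proof -
  have fact2: "2 ^ m * fact m \<le> (fact (2 * m) :: real)" for m
  proof (induction m)
    case (Suc m)
    have "2 ^ Suc m * fact (Suc m) = (2 * real m + 2) * (2 ^ m * fact m)"
      by (simp add: algebra_simps)
    also have "\<dots> \<le> (2 * real m + 2) * (2 * real m + 1) * fact (2 * m)"
      using Suc by (intro order.trans[OF mult_left_mono[OF Suc]]) (auto simp: algebra_simps)
    also have "\<dots> = fact (2 * Suc m)"
      by (simp add: algebra_simps)
    finally show ?case .
  qed simp
  let ?f = "\<lambda>k. if even k then x ^ k /\<^sub>R fact k else 0"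
  have "(\<lambda>m. ?f (2 * m)) sums cosh x"
  proof -
    have "strict_mono (\<lambda>m::nat. 2 * m)" by (auto simp: strict_mono_def)
    moreover have "?f k = 0" if "k \<notin> range (\<lambda>m. 2 * m)" for k
      using that by (auto elim!: evenE)
    ultimately show ?thesis
      using cosh_converges[of x] sums_mono_reindex[of "\<lambda>m. 2 * m" ?f] by blast
  qed
  then have A: "(\<lambda>m. (x\<^sup>2) ^ m / fact (2 * m)) sums cosh x"
    by (simp add: power_mult divide_inverse_commute)
  have "(\<lambda>m. (x\<^sup>2 / 2) ^ m /\<^sub>R fact m) sums exp (x\<^sup>2 / 2)"
    by (rule exp_converges)
  then have B: "(\<lambda>m. (x\<^sup>2) ^ m / (2 ^ m * fact m)) sums exp (x\<^sup>2 / 2)"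
    by (simp add: power_divide field_simps)
  show ?thesis
    by (rule sums_le[OF _ A B]) (auto intro!: divide_left_mono fact2)
qed

text \<open>By convexity the exponential lies below its chord over [-1, 1]. The chord is affine in
  \<open>c\<close>, which is the shape of a Riesz factor once \<open>c\<close> is a cosine.\<close>

lemma exp_mult_le_cosh_sinh:
  fixes b c :: real
  assumes "\<bar>c\<bar> \<le> 1"
  shows "exp (b * c) \<le> cosh b + sinh b * c"
proof -
  have "exp ((1 - (1 + c) / 2) *\<^sub>R (-b) + ((1 + c) / 2) *\<^sub>R b)
      \<le> (1 - (1 + c) / 2) * exp (-b) + ((1 + c) / 2) * exp b"
    using assms by (intro convex_onD[OF exp_convex]) auto
  also have "\<dots> = cosh b + sinh b * c"
    by (simp add: cosh_def sinh_def field_simps)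
  finally show ?thesis
    by (simp add: field_simps)
qed

text \<open>The chord bound, applied factor by factor, dominates the exponential by a Riesz product
  whose mean is exactly the product of the \<open>cosh (b k)\<close>.\<close>

lemma exp_moment_superlacunary:
  fixes n :: "nat \<Rightarrow> nat"
  assumes "\<And>k. (\<Sum>i<k. n i) < n k"
  shows "integral {-pi..pi} (\<lambda>x. exp (\<Sum>k<N. b k * cos (real (n k) * x + \<theta> k)))
    \<le> 2 * pi * exp ((\<Sum>k<N. (b k)\<^sup>2) / 2)"
proof -
  have "integral {-pi..pi} (\<lambda>x. exp (\<Sum>k<N. b k * cos (real (n k) * x + \<theta> k)))
    \<le> integral {-pi..pi} (\<lambda>x. \<Prod>k<N. cosh (b k) + sinh (b k) * cos (real (n k) * x + \<theta> k))"
  proof (intro integral_le integrable_continuous_interval continuous_intros)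
    fix x
    show "exp (\<Sum>k<N. b k * cos (real (n k) * x + \<theta> k))
        \<le> (\<Prod>k<N. cosh (b k) + sinh (b k) * cos (real (n k) * x + \<theta> k))"
      by (subst exp_sum) (auto intro!: prod_mono exp_mult_le_cosh_sinh)
  qed
  also have "\<dots> = 2 * pi * (\<Prod>k<N. cosh (b k))"
    by (rule integral_Riesz_product[OF assms])
  also have "(\<Prod>k<N. cosh (b k)) \<le> (\<Prod>k<N. exp ((b k)\<^sup>2 / 2))"
    by (intro prod_mono) (auto simp: cosh_le_exp_half_square)
  also have "\<dots> = exp ((\<Sum>k<N. (b k)\<^sup>2) / 2)"
    by (simp add: exp_sum sum_divide_distrib)
  finally show ?thesis by simp
qed

text \<open>Splitting the indices into residue classes modulo \<open>q\<close> makes each class lacunary with ratio 2.\<close>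
lemma exp_moment_lacunary:
  fixes n :: "nat \<Rightarrow> nat" and lam :: real
  assumes lam: "lam > 1" "lam ^ q \<ge> 2" "q > 0"
    and n: "\<And>k. n k > 0" "\<And>k. real (n (Suc k)) \<ge> lam * real (n k)"
  shows "integral {-pi..pi} (\<lambda>x. exp (\<Sum>k<N*q. b k * cos (real (n k) * x + \<theta> k)))
    \<le> 2 * pi * exp ((real q)\<^sup>2 / 2 * (\<Sum>k<N*q. (b k)\<^sup>2))"
proof -
  have pow: "real (n (k + m)) \<ge> lam ^ m * real (n k)" for k m
  proof (induction m)
    case (Suc m)
    have "lam ^ Suc m * real (n k) \<le> lam * real (n (k + m))"
      using Suc lam(1) by (simp add: mult.assoc)
    then show ?case using n(2)[of "k + m"] by simp
  qed simp
  have dbl: "n (k + q) \<ge> 2 * n k" for k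
  proof -
    have "real (2 * n k) \<le> lam ^ q * real (n k)"
      using lam(2) by (simp add: mult_right_mono)
    then show ?thesis using pow[of q k] by linarith
  qed
  define n' where "n' i j = n (j * q + i)" for i j
  have sup: "(\<Sum>j<k. n' i j) < n' i k" for i k
  proof (induction k)
    case 0
    then show ?case using n(1) by (simp add: n'_def)
  next
    case (Suc k)
    have "n' i (Suc k) \<ge> 2 * n' i k"
      using dbl[of "k * q + i"] by (simp add: n'_def algebra_simps)
    then show ?case using Suc by simp
  qed
  have split: "(\<Sum>k<N*q. g k) = (\<Sum>i<q. \<Sum>j<N. g (j * q + i))" for g :: "nat \<Rightarrow> real"
  proof -
    have "(\<Sum>k<N*q. g k) = (\<Sum>m<N. sum g {m*q..<m*q+q})"
      by (rule sum.nat_group[symmetric])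
    also have "\<dots> = (\<Sum>m<N. \<Sum>i<q. g (m * q + i))"
    proof (rule sum.cong[OF refl])
      fix m
      show "sum g {m*q..<m*q+q} = (\<Sum>i<q. g (m * q + i))"
        using sum.shift_bounds_nat_ivl[of g 0 "m * q" q]
        by (simp add: add.commute lessThan_atLeast0)
    qed
    also have "\<dots> = (\<Sum>i<q. \<Sum>j<N. g (j * q + i))"
      by (rule sum.swap)
    finally show ?thesis .
  qed
  \<comment> \<open>The factor \<open>real q\<close> turns the full sum into the average of the
    \<open>Y i\<close>, so that convexity of \<open>exp\<close> separates the classes. It is the
    source of \<open>(real q)\<^sup>2\<close> in the exponent.\<close>
  define Y where "Y i x = (\<Sum>j<N. (real q * b (j * q + i)) * cos (real (n' i j) * x + \<theta> (j * q + i)))" for i x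
  have Y_int: "(\<lambda>x. exp (Y i x)) integrable_on {-pi..pi}" for i
    unfolding Y_def by (intro integrable_continuous_interval continuous_intros)
  have Y_le: "integral {-pi..pi} (\<lambda>x. exp (Y i x)) \<le> 2 * pi * exp ((real q)\<^sup>2 / 2 * (\<Sum>k<N*q. (b k)\<^sup>2))"
    if i: "i < q" for i
  proof -
    have "integral {-pi..pi} (\<lambda>x. exp (Y i x)) \<le> 2 * pi * exp ((\<Sum>j<N. (real q * b (j * q + i))\<^sup>2) / 2)"
      unfolding Y_def by (rule exp_moment_superlacunary[OF sup])
    also have "(\<Sum>j<N. (real q * b (j * q + i))\<^sup>2) / 2 = (real q)\<^sup>2 / 2 * (\<Sum>j<N. (b (j * q + i))\<^sup>2)"
      by (simp add: power_mult_distrib sum_distrib_left sum_divide_distrib)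
    also have "(\<Sum>j<N. (b (j * q + i))\<^sup>2) \<le> (\<Sum>i<q. \<Sum>j<N. (b (j * q + i))\<^sup>2)"
      using i by (intro member_le_sum[where f = "\<lambda>i. \<Sum>j<N. (b (j * q + i))\<^sup>2"]) (auto intro: sum_nonneg)
    also have "\<dots> = (\<Sum>k<N*q. (b k)\<^sup>2)"
      by (rule split[symmetric])
    finally show ?thesis
      by (simp add: mult_left_mono)
  qed
  have "integral {-pi..pi} (\<lambda>x. exp (\<Sum>k<N*q. b k * cos (real (n k) * x + \<theta> k)))
     \<le> integral {-pi..pi} (\<lambda>x. \<Sum>i<q. (1 / real q) * exp (Y i x))"
  proof (intro integral_le)
    fix x
    have "(\<Sum>k<N*q. b k * cos (real (n k) * x + \<theta> k)) = (\<Sum>i<q. (1 / real q) *\<^sub>R Y i x)"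
      unfolding split Y_def n'_def using lam(3)
      by (simp add: sum_distrib_left sum_divide_distrib field_simps)
    also have "exp \<dots> \<le> (\<Sum>i<q. (1 / real q) * exp (Y i x))"
      using lam(3) by (intro convex_on_sum[OF _ _ exp_convex]) auto
    finally show "exp (\<Sum>k<N*q. b k * cos (real (n k) * x + \<theta> k)) \<le> (\<Sum>i<q. (1 / real q) * exp (Y i x))" .
  qed (unfold Y_def, (intro integrable_continuous_interval continuous_intros)+)
  also have "\<dots> = (\<Sum>i<q. (1 / real q) * integral {-pi..pi} (\<lambda>x. exp (Y i x)))"
    using Y_int by (subst integral_sum) (auto intro!: integrable_on_divide)
  also have "\<dots> \<le> (\<Sum>i<q. (1 / real q) * (2 * pi * exp ((real q)\<^sup>2 / 2 * (\<Sum>k<N*q. (b k)\<^sup>2))))"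
    by (intro sum_mono mult_left_mono Y_le) auto
  also have "\<dots> = 2 * pi * exp ((real q)\<^sup>2 / 2 * (\<Sum>k<N*q. (b k)\<^sup>2))"
    using lam(3) by simp
  finally show ?thesis .
qed

lemma lacunary_tail:
  fixes n :: "nat \<Rightarrow> nat" and lam V s :: real
  assumes lam: "lam > 1" "lam ^ q \<ge> 2" "q > 0"
    and n: "\<And>k. n k > 0" "\<And>k. real (n (Suc k)) \<ge> lam * real (n k)"
    and b: "summable (\<lambda>k. \<bar>b k\<bar>)" and V: "V > 0" "\<And>N. (\<Sum>k<N. (b k)\<^sup>2) \<le> V" and s: "s \<ge> 0"
  defines "M \<equiv> restrict_space lborel {-pi..pi}"
  shows "emeasure M {x\<in>space M. (\<Sum>k. b k * cos (real (n k) * x + \<theta> k)) > s}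
    \<le> ennreal (2 * pi * exp 1 * exp (- s\<^sup>2 / (2 * (real q)\<^sup>2 * V)))"
\<comment> \<open>For \<open>s = 0\<close> the Chernoff parameter would vanish, but the bound then
  already exceeds the total measure \<open>2 * pi\<close>.\<close>
proof (cases "s = 0")
  case True
  have "emeasure M {x\<in>space M. (\<Sum>k. b k * cos (real (n k) * x + \<theta> k)) > s} \<le> emeasure M (space M)"
    by (rule emeasure_mono) auto
  also have "\<dots> = ennreal (2 * pi)"
    by (simp add: M_def space_restrict_space emeasure_restrict_space)
  also have "\<dots> \<le> ennreal (2 * pi * exp 1 * exp (- s\<^sup>2 / (2 * (real q)\<^sup>2 * V)))"
    using True by (intro ennreal_leI) simp
  finally show ?thesis .
next
  case False
  let ?S = "\<lambda>x. \<Sum>k. b k * cos (real (n k) * x + \<theta> k)"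
  \<comment> \<open>This value minimises
    \<open>- t * s + (real q)\<^sup>2 * t\<^sup>2 * V / 2\<close>.\<close>
  define t where "t = s / ((real q)\<^sup>2 * V)"
  have t: "t > 0" using False s V lam by (simp add: t_def)
  have "uniform_limit UNIV (\<lambda>N x. \<Sum>k<N. b k * cos (real (n k) * x + \<theta> k)) ?S sequentially"
    by (rule Weierstrass_m_test[OF _ b]) (auto simp: abs_mult intro!: mult_left_le)
  then have "\<forall>\<^sub>F N in sequentially. \<forall>x\<in>UNIV. dist (\<Sum>k<N. b k * cos (real (n k) * x + \<theta> k)) (?S x) < 1 / t"
    by (rule uniform_limitD) (use t in auto)
  then obtain N where N: "\<And>m x. m \<ge> N \<Longrightarrow> dist (\<Sum>k<m. b k * cos (real (n k) * x + \<theta> k)) (?S x) < 1 / t"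
    unfolding eventually_sequentially by blast
  \<comment> \<open>The series is cut at a multiple of \<open>q\<close>, as the moment bound
    requires. The uniform error \<open>1 / t\<close> becomes 1 after multiplication by
    \<open>t\<close>, which explains the factor \<open>exp 1\<close> in the result.\<close>
  let ?T = "\<lambda>x. \<Sum>k<N*q. t * b k * cos (real (n k) * x + \<theta> k)"
  have ST: "t * ?S x \<le> 1 + ?T x" for x
  proof -
    have "?S x \<le> 1 / t + (\<Sum>k<N*q. b k * cos (real (n k) * x + \<theta> k))"
      using N[of "N * q" x] lam by (simp add: dist_real_def)
    then have "t * ?S x \<le> t * (1 / t + (\<Sum>k<N*q. b k * cos (real (n k) * x + \<theta> k)))"
      using t by (intro mult_left_mono) auto
    also have "\<dots> = 1 + ?T x"
      using t by (simp add: distrib_left sum_distrib_left mult.assoc)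
    finally show ?thesis .
  qed
  have [measurable]: "?S \<in> borel_measurable M"
    unfolding M_def by (rule measurable_restrict_space1) measurable
  have "emeasure M {x\<in>space M. ?S x > s} \<le> emeasure M {x\<in>space M. ?S x \<ge> s}"
    by (rule emeasure_mono) auto
  also have "\<dots> \<le> ennreal (exp (-t * s)) * (\<integral>\<^sup>+x. ennreal (exp (t * ?S x)) * indicator (space M) x \<partial>M)"
    by (rule Chernoff_ineq_nn_integral_ge[OF t]) measurable
  also have "(\<integral>\<^sup>+x. ennreal (exp (t * ?S x)) * indicator (space M) x \<partial>M)
     \<le> (\<integral>\<^sup>+x. ennreal (exp (1 + ?T x)) \<partial>M)"
    using ST by (intro nn_integral_mono) (auto simp: indicator_def intro!: ennreal_leI)
  also have "\<dots> = (\<integral>\<^sup>+x. ennreal (exp 1 * exp (?T x)) * indicator {-pi..pi} x \<partial>lborel)"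
    unfolding M_def by (subst nn_integral_restrict_space) (auto simp: exp_add)
  also have "\<dots> = ennreal (exp 1 * integral {-pi..pi} (\<lambda>x. exp (?T x)))"
    by (intro nn_integral_has_integral_lebesgue' has_integral_mult_right integrable_integral
          integrable_continuous_interval continuous_intros) auto
  also have "integral {-pi..pi} (\<lambda>x. exp (?T x)) \<le> 2 * pi * exp ((real q)\<^sup>2 / 2 * (\<Sum>k<N*q. (t * b k)\<^sup>2))"
    by (rule exp_moment_lacunary[where n = n, OF lam n])
  also have "(real q)\<^sup>2 / 2 * (\<Sum>k<N*q. (t * b k)\<^sup>2) = (real q)\<^sup>2 / 2 * t\<^sup>2 * (\<Sum>k<N*q. (b k)\<^sup>2)"
    by (simp add: power_mult_distrib sum_distrib_left mult.assoc)
  also have "\<dots> \<le> (real q)\<^sup>2 / 2 * t\<^sup>2 * V"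
    by (intro mult_left_mono V) auto
  also have "ennreal (exp (-t * s)) * ennreal (exp 1 * (2 * pi * exp ((real q)\<^sup>2 / 2 * t\<^sup>2 * V))) =
      ennreal (2 * pi * exp 1 * (exp (-t * s) * exp ((real q)\<^sup>2 / 2 * t\<^sup>2 * V)))"
    by (subst ennreal_mult[symmetric]) (auto simp: mult_ac)
  also have "exp (-t * s) * exp ((real q)\<^sup>2 / 2 * t\<^sup>2 * V) = exp (- s\<^sup>2 / (2 * (real q)\<^sup>2 * V))"
    unfolding exp_add[symmetric] t_def using lam V by (simp add: field_simps power2_eq_square)
  finally show ?thesis
    by (simp add: mult_left_mono ennreal_leI)
qed

section \<open>A law of the iterated logarithm for subgaussian increments\<close>

text \<open>Descend through the binary digits of \<open>m\<close>: if \<open>m\<close> lies in the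
  left half of the current interval nothing is paid, otherwise one step to the midpoint is. Each
  scale is thus used at most once.\<close>

lemma dyadic_chaining:
  fixes x S :: "nat \<Rightarrow> real"
  assumes S: "\<And>g. S g \<ge> 0"
    and inc: "\<And>g p. g < j \<Longrightarrow> (p + 1) * 2 ^ g \<le> 2 ^ j \<Longrightarrow> x ((p + 1) * 2 ^ g) - x (p * 2 ^ g) \<le> S g"
    and "h \<le> j" "p * 2 ^ h \<le> m" "m < (p + 1) * 2 ^ h" "(p + 1) * 2 ^ h \<le> 2 ^ j"
  shows "x m - x (p * 2 ^ h) \<le> (\<Sum>g<h. S g)"
  using assms(3-)
proof (induction h arbitrary: p)
  case 0
  then have "m = p" by simp
  then show ?case by simp
next
  case (Suc h)
  show ?case
  proof (cases "m < (2 * p + 1) * 2 ^ h")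
    case True
    have "x m - x (2 * p * 2 ^ h) \<le> (\<Sum>g<h. S g)"
      by (rule Suc.IH) (use Suc.prems True in \<open>auto simp: algebra_simps\<close>)
    then show ?thesis
      using S[of h] by (simp add: mult_ac)
  next
    case False
    have "x m - x ((2 * p + 1) * 2 ^ h) \<le> (\<Sum>g<h. S g)"
      by (rule Suc.IH) (use Suc.prems False in \<open>auto simp: algebra_simps\<close>)
    moreover have "x ((2 * p + 1) * 2 ^ h) - x ((2 * p) * 2 ^ h) \<le> S h"
      by (rule inc) (use Suc.prems in \<open>auto simp: algebra_simps\<close>)
    moreover have "(2 * p) * 2 ^ h = p * 2 ^ Suc h" by simp
    ultimately show ?thesis by (simp add: mult_ac)
  qed
qed

text \<open>A union bound over the \<open>2 ^ j\<close> times would cost \<open>ln (2 ^ j)\<close> in place of \<open>ln j\<close>; hence the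
  chaining over dyadic intervals, where the level of length \<open>2 ^ (j - i)\<close> gets the threshold
  \<open>4 * \<sigma> * (7/8) ^ i * sqrt (2 ^ j * ln j)\<close>.\<close>
lemma lil_chaining:
  fixes X :: "nat \<Rightarrow> 'a \<Rightarrow> real" and \<sigma> B :: real
  assumes X[measurable]: "\<And>m. X m \<in> borel_measurable M"
    and \<sigma>: "\<sigma> > 0" and B: "B \<ge> 0"
    and tail: "\<And>l m s. l < m \<Longrightarrow> s \<ge> 0 \<Longrightarrow>
      emeasure M {x\<in>space M. X m x - X l x > s} \<le> ennreal (B * exp (- s\<^sup>2 / (2 * \<sigma>\<^sup>2 * (real m - real l))))"
  shows "AE x in M. \<forall>\<^sub>F j in sequentially. \<forall>m<2^j. X m x \<le> X 0 x + 32 * \<sigma> * sqrt (2 ^ j * ln (real j))"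
proof -
  \<comment> \<open>The ratio 7/8 is below 1, so the thresholds have a bounded sum (at most 8 times
    the prefactor, whence 32). Yet \<open>2 * (7/8)\<^sup>2 = 49/32\<close> exceeds 1, so the
    exponent \<open>8 * (49/32) ^ i * ln j\<close> grows with \<open>i\<close> and pays for the
    \<open>2 ^ i\<close> intervals of that level.\<close>
  define s where "s j i = 4 * \<sigma> * (7/8) ^ i * sqrt (2 ^ j * ln (real j))" for j i :: nat
  define E where "E j i p = {x\<in>space M. X ((p + 1) * 2 ^ (j - i)) x - X (p * 2 ^ (j - i)) x > s j i}" for j i p :: nat
  \<comment> \<open>Discarding \<open>j < 3\<close> guarantees \<open>ln j \<ge> 1\<close>, and
    Borel--Cantelli does not see finitely many \<open>j\<close>.\<close>
  define A where "A j = (if j < 3 then {} else (\<Union>i\<in>{1..j}. \<Union>p\<in>{..<2^i}. E j i p))" for j :: nat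
  have [measurable]: "E j i p \<in> sets M" for j i p
    unfolding E_def by measurable
  have [measurable]: "A j \<in> sets M" for j
    by (auto simp: A_def)
  have E_le: "emeasure M (E j i p) \<le> ennreal (B * (exp (-2 * ln j) * (1/4) ^ i))"
    if "j \<ge> 3" "i \<in> {1..j}" for i j p
  proof -
    have ln1: "ln (real j) \<ge> 1"
    proof -
      have "exp 1 \<le> real j" using exp_le that(1) by linarith
      then show ?thesis using that(1) by (subst ln_ge_iff) auto
    qed
    have "emeasure M (E j i p) \<le> ennreal (B * exp (- (s j i)\<^sup>2 / (2 * \<sigma>\<^sup>2 *
        (real ((p + 1) * 2 ^ (j - i)) - real (p * 2 ^ (j - i))))))"
      unfolding E_def using \<sigma> ln1 by (intro tail) (auto simp: s_def)
    also have "(s j i)\<^sup>2 / (2 * \<sigma>\<^sup>2 * (real ((p + 1) * 2 ^ (j - i)) - real (p * 2 ^ (j - i)))) =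
        8 * (49/32) ^ i * ln j"
    proof -
      have sq: "(s j i)\<^sup>2 = 16 * \<sigma>\<^sup>2 * (49/64) ^ i * (2 ^ j * ln j)"
        using ln1 by (simp add: s_def power_mult_distrib power_divide power_mult[symmetric] mult.commute[of _ 2])
          (simp add: power_mult)
      have split: "(2::real) ^ j = 2 ^ (j - i) * 2 ^ i"
        using that by (simp add: power_add[symmetric])
      have pow: "(49/32) ^ i = (49/64 :: real) ^ i * 2 ^ i"
        by (simp add: power_mult_distrib[symmetric])
      have len: "real ((p + 1) * 2 ^ (j - i)) - real (p * 2 ^ (j - i)) = 2 ^ (j - i)"
        by (simp add: algebra_simps)
      have "16 * \<sigma>\<^sup>2 * c * (d * t * L) / (2 * \<sigma>\<^sup>2 * d) = 8 * (c * t) * L" if "d \<noteq> 0" for c d t L :: real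
        using \<sigma> that by (simp add: field_simps)
      then show ?thesis unfolding sq len pow split by simp
    qed
    then have "- (s j i)\<^sup>2 / (2 * \<sigma>\<^sup>2 * (real ((p + 1) * 2 ^ (j - i)) - real (p * 2 ^ (j - i)))) =
        - (8 * (49/32) ^ i * ln j)" by simp
    also have "exp (- (8 * (49/32) ^ i * ln (real j))) \<le> exp (-2 * ln j) * (1/4) ^ i"
    proof -
      \<comment> \<open>Linear growth of \<open>(49/32) ^ i\<close> is enough: it yields a factor
        \<open>j\<close> to the power -2, summable over \<open>j\<close>, and a factor
        \<open>(1/4) ^ i\<close>, which beats the number \<open>2 ^ i\<close> of intervals.\<close>
      have "1 + real i * (17/32) \<le> (1 + 17/32) ^ i"
        by (rule Bernoulli_inequality) simp
      then have "8 * (1 + real i / 2) \<le> 8 * (49/32::real) ^ i"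
        by simp
      then have "8 * (1 + real i / 2) * ln j \<le> 8 * (49/32) ^ i * ln j"
        using ln1 by (intro mult_right_mono) auto
      moreover have "2 * ln j + 2 * real i \<le> 8 * (1 + real i / 2) * ln j"
      proof -
        have "real i * 1 \<le> real i * ln j"
          using ln1 by (intro mult_left_mono) auto
        then show ?thesis using ln1 by (simp add: algebra_simps)
      qed
      ultimately have "- (8 * (49/32) ^ i * ln (real j)) \<le> -2 * ln j + real i * (-2)"
        by simp
      then have "exp (- (8 * (49/32) ^ i * ln (real j))) \<le> exp (-2 * ln j) * exp (real i * (-2))"
        by (simp add: exp_add[symmetric])
      also have "exp (real i * (-2)) = exp (-2) ^ i"
        by (rule exp_of_nat_mult)
      also have "\<dots> \<le> (1/4::real) ^ i"
      proof (intro power_mono)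
        have "2 * 2 \<le> exp 1 * (exp 1 :: real)"
          using exp_ge_add_one_self[of 1] by (intro mult_mono) auto
        then have "4 \<le> exp (2::real)" by (simp add: exp_add[symmetric])
        then show "exp (-2) \<le> (1/4::real)"
          by (simp add: exp_minus field_simps)
      qed auto
      finally show ?thesis by simp
    qed
    finally show ?thesis
      using B by (simp add: ennreal_leI mult_left_mono)
  qed
  have A_le: "emeasure M (A j) \<le> ennreal (B * (1 / (real j)\<^sup>2))" for j
  proof (cases "j < 3")
    case False
    then have "emeasure M (A j) \<le> (\<Sum>i\<in>{1..j}. emeasure M (\<Union>p\<in>{..<2^i}. E j i p))"
      unfolding A_def by (auto intro!: emeasure_subadditive_finite)
    also have "\<dots> \<le> (\<Sum>i\<in>{1..j}. \<Sum>p<2^i. emeasure M (E j i p))"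
      by (intro sum_mono emeasure_subadditive_finite) auto
    also have "\<dots> \<le> (\<Sum>i\<in>{1..j}. \<Sum>p<(2::nat)^i. ennreal (B * (exp (-2 * ln j) * (1/4) ^ i)))"
      using False by (intro sum_mono E_le) auto
    also have "\<dots> = ennreal (\<Sum>i\<in>{1..j}. 2 ^ i * (B * (exp (-2 * ln j) * (1/4) ^ i)))"
      using B by (simp add: ennreal_of_nat_eq_real_of_nat ennreal_mult[symmetric])
    also have "(\<Sum>i\<in>{1..j}. 2 ^ i * (B * (exp (-2 * ln j) * (1/4) ^ i))) =
        B * exp (-2 * ln j) * (\<Sum>i\<in>{1..j}. (1/2) ^ i)"
      unfolding sum_distrib_left
    proof (rule sum.cong[OF refl])
      fix i
      have "(2::real) ^ i * (1/4) ^ i = (1/2) ^ i"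
        by (simp add: power_mult_distrib[symmetric])
      then show "2 ^ i * (B * (exp (-2 * ln j) * (1/4) ^ i)) = B * exp (-2 * ln j) * (1/2) ^ i"
        by (metis mult.assoc mult.left_commute)
    qed
    also have "\<dots> \<le> B * exp (-2 * ln j) * 1"
    proof -
      have "(\<Sum>i\<in>{1..j}. (1/2::real) ^ i) = 1 - (1/2) ^ j"
        by (induction j) (auto simp: field_simps)
      then show ?thesis using B by (intro mult_left_mono) auto
    qed
    also have "exp (-2 * ln (real j)) = 1 / (real j)\<^sup>2"
    proof -
      have "exp (-2 * ln (real j)) = inverse (exp (ln (real j)) * exp (ln (real j)))"
        by (simp add: exp_minus[symmetric] exp_add[symmetric])
      then show ?thesis
        using False by (simp add: power2_eq_square field_simps)
    qed
    finally show ?thesis using B by (simp add: ennreal_leI)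
  qed (simp add: A_def)
  have "AE x in M. \<forall>\<^sub>F j in sequentially. x \<in> space M - A j"
  proof (rule borel_cantelli_AE1)
    show "emeasure M (A n) < \<infinity>" for n
      using A_le[of n] by (simp add: order.strict_trans1)
    have "summable (\<lambda>n. B * (1 / (real n)\<^sup>2))"
      using inverse_power_summable[of 2] by (intro summable_mult) (simp add: divide_inverse)
    moreover have "norm (measure M (A n)) \<le> B * (1 / (real n)\<^sup>2)" for n
      using A_le[of n] B by (simp add: measure_def enn2real_leI)
    ultimately show "summable (\<lambda>n. measure M (A n))"
      by (rule summable_comparison_test'[where N = 0])
  qed auto
  then show ?thesis
  proof eventually_elim
    case (elim x)
    from elim eventually_ge_at_top[of 3] show ?case
    proof eventually_elim
      case (elim j)
      have ln0: "ln (real j) \<ge> 0" using elim by simp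
      show ?case
      proof (intro allI impI)
        fix m :: nat
        assume m: "m < 2 ^ j"
        have "X m x - X (0 * 2 ^ j) x \<le> (\<Sum>g<j. s j (j - g))"
        proof (rule dyadic_chaining[where x = "\<lambda>m. X m x" and j = j])
          show "s j (j - g) \<ge> 0" for g
            using \<sigma> ln0 by (simp add: s_def)
          fix g p :: nat
          assume g: "g < j" and p: "(p + 1) * 2 ^ g \<le> 2 ^ j"
          have "(2::nat) ^ j = 2 ^ (j - g) * 2 ^ g"
            using g by (simp add: power_add[symmetric])
          with p have "p + 1 \<le> 2 ^ (j - g)" by (metis mult_le_cancel2 zero_less_numeral zero_less_power)
          with g elim have "x \<notin> E j (j - g) p"
            by (auto simp: A_def not_less)
          then show "X ((p + 1) * 2 ^ g) x - X (p * 2 ^ g) x \<le> s j (j - g)"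
            using g elim by (auto simp: E_def not_less)
        qed (use m in auto)
        also have "(\<Sum>g<j. s j (j - g)) = (\<Sum>i\<in>{1..j}. s j i)"
          by (rule sum.reindex_bij_witness[of _ "\<lambda>i. j - i" "\<lambda>g. j - g"]) auto
        also have "\<dots> = 4 * \<sigma> * sqrt (2 ^ j * ln (real j)) * (\<Sum>i\<in>{1..j}. (7/8) ^ i)"
          by (simp add: s_def sum_distrib_left mult_ac)
        also have "\<dots> \<le> 4 * \<sigma> * sqrt (2 ^ j * ln (real j)) * 8"
        proof -
          have "(\<Sum>i\<in>{1..j}. (7/8::real) ^ i) = 7 - 7 * (7/8) ^ j"
            by (induction j) (auto simp: field_simps)
          then have "(\<Sum>i\<in>{1..j}. (7/8::real) ^ i) \<le> 8"
            using zero_le_power[of "7/8 :: real" j] by linarith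
          then show ?thesis using \<sigma> ln0 by (intro mult_left_mono) auto
        qed
        finally show "X m x \<le> X 0 x + 32 * \<sigma> * sqrt (2 ^ j * ln (real j))"
          by simp
      qed
    qed
  qed
qed

section \<open>Riemann--Stieltjes integrals with respect to a weight\<close>

text \<open>\<open>RS_integral\<close> is a definite description, so uniqueness is needed to
  evaluate it. An equidistant partition finer than both meshes would put one sum closer than half
  the distance to both values.\<close>

lemma has_RS_integral_unique:
  assumes "a < b" "has_RS_integral f g a b I" "has_RS_integral f g a b J"
  shows "I = J"
proof (rule ccontr)
  assume "I \<noteq> J"
  then have e: "\<bar>I - J\<bar> / 2 > 0" by simp
  obtain d1 where d1: "d1 > 0" "\<And>m x t. x 0 = a \<Longrightarrow> x m = b \<Longrightarrow>
      \<forall>i<m. x i < x (Suc i) \<and> x (Suc i) - x i < d1 \<and> x i \<le> t i \<and> t i \<le> x (Suc i) \<Longrightarrow>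
      \<bar>(\<Sum>i<m. f (t i) * (g (x (Suc i)) - g (x i))) - I\<bar> < \<bar>I - J\<bar> / 2"
    using assms(2) e unfolding has_RS_integral_def by meson
  obtain d2 where d2: "d2 > 0" "\<And>m x t. x 0 = a \<Longrightarrow> x m = b \<Longrightarrow>
      \<forall>i<m. x i < x (Suc i) \<and> x (Suc i) - x i < d2 \<and> x i \<le> t i \<and> t i \<le> x (Suc i) \<Longrightarrow>
      \<bar>(\<Sum>i<m. f (t i) * (g (x (Suc i)) - g (x i))) - J\<bar> < \<bar>I - J\<bar> / 2"
    using assms(3) e unfolding has_RS_integral_def by meson
  define d where "d = min d1 d2"
  have d: "d > 0" "d \<le> d1" "d \<le> d2" using d1(1) d2(1) by (auto simp: d_def)
  obtain m :: nat where m: "(b - a) / d < real m"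
    using reals_Archimedean2 by blast
  then have "real m > 0"
    using d(1) assms(1) by (meson diff_gt_0_iff_gt divide_pos_pos less_trans)
  then have mpos: "m > 0" by simp
  define x where "x i = a + real i * ((b - a) / real m)" for i
  have step: "x (Suc i) - x i = (b - a) / real m" for i
    by (simp add: x_def algebra_simps add_divide_distrib[symmetric])
  have "(b - a) / real m < d"
    using m mpos d(1) by (simp add: field_simps)
  moreover have "(b - a) / real m > 0"
    using assms(1) mpos by simp
  ultimately have P: "x i < x (Suc i) \<and> x (Suc i) - x i < d \<and> x i \<le> x i \<and> x i \<le> x (Suc i)"
    if "d = d1 \<or> d = d2" for i d
    using step[of i] that d by auto
  have ends: "x 0 = a" "x m = b"
    using mpos by (auto simp: x_def)
  have "\<bar>(\<Sum>i<m. f (x i) * (g (x (Suc i)) - g (x i))) - I\<bar> < \<bar>I - J\<bar> / 2"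
    by (rule d1(2)[OF ends]) (use P in blast)
  moreover have "\<bar>(\<Sum>i<m. f (x i) * (g (x (Suc i)) - g (x i))) - J\<bar> < \<bar>I - J\<bar> / 2"
    by (rule d2(2)[OF ends]) (use P in blast)
  moreover have "False" if "\<bar>S - I\<bar> < \<bar>I - J\<bar> / 2" "\<bar>S - J\<bar> < \<bar>I - J\<bar> / 2" for S
    using that by (simp add: abs_if split: if_splits)
  ultimately show False by blast
qed

lemma RS_integral_eqI:
  assumes "a < b" "has_RS_integral f g a b I"
  shows "RS_integral f g a b = I"
  unfolding RS_integral_def using assms has_RS_integral_unique by blast

text \<open>The clamping at 1 makes the right inverse monotone on the whole real line, hence Borel.\<close>
definition winv :: "(real \<Rightarrow> real) \<Rightarrow> real \<Rightarrow> real" where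
  "winv v y = (SOME r. r \<in> {0..<1} \<and> v r = max 1 y)"

context
  fixes v :: "real \<Rightarrow> real"
  assumes w: "weight v"
begin

lemma weight_mono: "0 \<le> r \<Longrightarrow> r \<le> s \<Longrightarrow> s < 1 \<Longrightarrow> v r \<le> v s"
  using w unfolding weight_def mono_on_def by auto

lemma weight_ge_1: "0 \<le> r \<Longrightarrow> r < 1 \<Longrightarrow> v r \<ge> 1"
  using weight_mono[of 0 r] w unfolding weight_def by auto

lemma weight_cont: "0 \<le> a \<Longrightarrow> b < 1 \<Longrightarrow> continuous_on {a..b} v"
  using w unfolding weight_def by (auto intro: continuous_on_subset)

lemma weight_surj:
  assumes "y \<ge> 1"
  obtains r where "r \<in> {0..<1}" "v r = y"
proof -
  have "\<forall>\<^sub>F r in at_left 1. v r \<ge> y"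
    using w unfolding weight_def filterlim_at_top by auto
  moreover have "\<forall>\<^sub>F r in at_left (1::real). r > 0"
    by (rule eventually_at_left_real[THEN eventually_mono]) auto
  moreover have "\<forall>\<^sub>F r in at_left (1::real). r < 1"
    by (auto simp: eventually_at_filter)
  ultimately have "\<forall>\<^sub>F r in at_left 1. v r \<ge> y \<and> r > 0 \<and> r < 1"
    by eventually_elim auto
  then obtain b where b: "v b \<ge> y" "b > 0" "b < 1"
    using eventually_happens' trivial_limit_at_left_real by blast
  have "\<exists>r\<ge>0. r \<le> b \<and> v r = y"
    using b assms w by (intro IVT') (auto intro!: weight_cont simp: weight_def)
  then obtain r where "r \<ge> 0" "r \<le> b" "v r = y" by blast
  with b have "r \<in> {0..<1}" "v r = y" by auto
  then show ?thesis by (rule that)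
qed

lemma winv: "winv v y \<in> {0..<1} \<and> v (winv v y) = max 1 y"
  unfolding winv_def by (rule someI_ex) (use weight_surj[of "max 1 y"] in auto)

lemma winv_less_1: "winv v y < 1" and winv_nonneg: "winv v y \<ge> 0"
  and v_winv: "y \<ge> 1 \<Longrightarrow> v (winv v y) = y"
  using winv[of y] by auto

lemma mono_winv: "mono (winv v)"
proof (rule monoI)
  fix x y :: real
  assume xy: "x \<le> y"
  show "winv v x \<le> winv v y"
  proof (cases "max 1 x = max 1 y")
    \<comment> \<open>The choice depends on \<open>y\<close> only through \<open>max 1 y\<close>, so
      equal clamped values select the same point.\<close>
    case True
    then show ?thesis by (simp add: winv_def)
  next
    case False
    then show ?thesis
      using xy winv[of x] winv[of y] weight_mono[of "winv v y" "winv v x"] by force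
  qed
qed

text \<open>The inequalities for \<open>y\<close> are strict because \<open>v\<close> may be flat:
  at \<open>y = v r\<close> the chosen preimage can lie outside the interval from \<open>r\<close>
  to \<open>s\<close>.\<close>

lemma winv_bounds:
  assumes "0 \<le> r" "r \<le> s" "s < 1" "v r < y" "y < v s"
  shows "r \<le> winv v y" "winv v y \<le> s"
proof -
  have "v (winv v y) = y"
    using assms weight_ge_1[of r] by (intro v_winv) auto
  with assms weight_mono[of "winv v y" r] weight_mono[of s "winv v y"] winv_nonneg[of y] winv_less_1[of y]
  show "r \<le> winv v y" "winv v y \<le> s"
    by linarith+
qed

lemma measurable_winv[measurable]: "winv v \<in> borel_measurable borel"
  using mono_winv by (rule borel_measurable_mono)

text \<open>The inverse jumps across flat stretches of \<open>v\<close>, so the composition need not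
  be continuous. It is Borel, and bounded because \<open>winv v\<close> maps \<open>{a..b}\<close>
  into a compact part of \<open>{0..<1}\<close>.\<close>

lemma winv_compose_integrable:
  fixes f :: "real \<Rightarrow> real"
  assumes f: "continuous_on {0..<1} f"
  shows "(\<lambda>y. f (winv v y)) integrable_on {a..b}"
proof (cases "a \<le> b")
  case True
  have "bounded (f ` {winv v a..winv v b})"
  proof (intro compact_imp_bounded compact_continuous_image)
    show "continuous_on {winv v a..winv v b} f"
      using winv_nonneg[of a] winv_less_1[of b] by (intro continuous_on_subset[OF f]) auto
  qed simp
  then obtain C where C: "\<And>r. r \<in> {winv v a..winv v b} \<Longrightarrow> \<bar>f r\<bar> \<le> C"
    unfolding bounded_iff by (metis imageI real_norm_def)
  have [measurable]: "(\<lambda>r. indicator {0..<1} r *\<^sub>R f r) \<in> borel_measurable borel"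
    using f by (intro borel_measurable_continuous_on_indicator) auto
  have "set_integrable lborel {a..b} (\<lambda>y. indicator {0..<1} (winv v y) *\<^sub>R f (winv v y))"
    unfolding set_integrable_def
  proof (rule integrableI_bounded_set_indicator[where B = C])
    show "(\<lambda>y. indicator {0..<1} (winv v y) *\<^sub>R f (winv v y)) \<in> borel_measurable lborel"
      by measurable
    show "AE y in lborel. y \<in> {a..b} \<longrightarrow> norm (indicator {0..<1} (winv v y) *\<^sub>R f (winv v y)) \<le> C"
      using C winv monoD[OF mono_winv] by (auto simp: indicator_def)
  qed (use True in \<open>auto simp: emeasure_lborel_Icc_eq\<close>)
  then have "(\<lambda>y. indicator {0..<1} (winv v y) *\<^sub>R f (winv v y)) integrable_on {a..b}"
    by (rule set_borel_integral_eq_integral)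
  moreover have "indicator {0..<1} (winv v y) *\<^sub>R f (winv v y) = f (winv v y)" for y
    using winv[of y] by simp
  ultimately show ?thesis by (simp only:)
qed auto

text \<open>A partition of \<open>{a..b}\<close> is carried by \<open>v\<close> to one of
  \<open>{v a..v b}\<close>. Inside each image cell \<open>winv v\<close> returns to the original
  cell, where \<open>f\<close> oscillates by less than \<eta>; the errors add up to at most
  \<open>\<eta> * (v b - v a)\<close>.\<close>

lemma RS_integral_weight:
  fixes f :: "real \<Rightarrow> real"
  assumes f: "continuous_on {0..<1} f" and ab: "0 \<le> a" "a < b" "b < 1"
  shows "RS_integral f v a b = integral {v a..v b} (\<lambda>y. f (winv v y))"
proof (rule RS_integral_eqI[OF ab(2)])
  have int: "(\<lambda>y. f (winv v y)) integrable_on {c..d}" for c d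
    by (rule winv_compose_integrable[OF f])
  have fab: "continuous_on {a..b} f"
    using ab by (intro continuous_on_subset[OF f]) auto
  have uc: "uniformly_continuous_on {a..b} f"
    by (rule compact_uniformly_continuous[OF fab]) simp
  show "has_RS_integral f v a b (integral {v a..v b} (\<lambda>y. f (winv v y)))"
    unfolding has_RS_integral_def
  proof (intro allI impI)
    fix \<epsilon> :: real
    assume \<epsilon>: "\<epsilon> > 0"
    \<comment> \<open>Adding 1 keeps the denominator positive when \<open>v\<close> is constant on
      \<open>{a..b}\<close>.\<close>
    define \<eta> where "\<eta> = \<epsilon> / (2 * (v b - v a + 1))"
    have vab: "v a \<le> v b" using ab by (intro weight_mono) auto
    have \<eta>: "\<eta> > 0" using \<epsilon> vab by (simp add: \<eta>_def)
    from uc \<eta> obtain \<delta> where \<delta>: "\<delta> > 0"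
      "\<And>s t. s \<in> {a..b} \<Longrightarrow> t \<in> {a..b} \<Longrightarrow> \<bar>s - t\<bar> < \<delta> \<Longrightarrow> \<bar>f s - f t\<bar> < \<eta>"
      unfolding uniformly_continuous_on_def dist_real_def by metis
    show "\<exists>\<delta>>0. \<forall>(m::nat) (x::nat \<Rightarrow> real) (t::nat \<Rightarrow> real).
        x 0 = a \<and> x m = b \<and>
        (\<forall>i<m. x i < x (Suc i) \<and> x (Suc i) - x i < \<delta> \<and> x i \<le> t i \<and> t i \<le> x (Suc i))
        \<longrightarrow> \<bar>(\<Sum>i<m. f (t i) * (v (x (Suc i)) - v (x i))) - integral {v a..v b} (\<lambda>y. f (winv v y))\<bar> < \<epsilon>"
    proof (intro exI[of _ \<delta>] conjI \<delta> allI impI)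
      fix m x t
      assume P: "x 0 = a \<and> x m = b \<and>
        (\<forall>i<m. x i < x (Suc i) \<and> x (Suc i) - x i < \<delta> \<and> x i \<le> t i \<and> t i \<le> x (Suc i))"
      have xmono: "x i \<le> x k" if "i \<le> k" "k \<le> m" for i k
        using that
      proof (induction k)
        case (Suc k)
        then have "i = Suc k \<or> x i \<le> x k" by (cases "i = Suc k") auto
        moreover have "x k < x (Suc k)" using P Suc.prems by auto
        ultimately show ?case by auto
      qed simp
      have xin: "x k \<in> {a..b}" if "k \<le> m" for k
        using xmono[of 0 k] xmono[of k m] P that by auto
      have split: "integral {v a..v (x k)} (\<lambda>y. f (winv v y)) =
          (\<Sum>i<k. integral {v (x i)..v (x (Suc i))} (\<lambda>y. f (winv v y)))" if "k \<le> m" for k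
        using that
      proof (induction k)
        case 0
        then show ?case using P by simp
      next
        case (Suc k)
        have "integral {v a..v (x k)} (\<lambda>y. f (winv v y)) +
            integral {v (x k)..v (x (Suc k))} (\<lambda>y. f (winv v y)) =
            integral {v a..v (x (Suc k))} (\<lambda>y. f (winv v y))"
          using xin[of k] xin[of "Suc k"] xmono[of k "Suc k"] ab Suc.prems
          by (intro Henstock_Kurzweil_Integration.integral_combine weight_mono int) auto
        then show ?case using Suc by simp
      qed
      have piece: "\<bar>f (t i) * (v (x (Suc i)) - v (x i)) -
          integral {v (x i)..v (x (Suc i))} (\<lambda>y. f (winv v y))\<bar> \<le> \<eta> * (v (x (Suc i)) - v (x i))"
        if i: "i < m" for i
      proof -
        have vv: "v (x i) \<le> v (x (Suc i))"
          using xin[of i] xin[of "Suc i"] xmono[of i "Suc i"] ab i by (intro weight_mono) auto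
        let ?J = "{v (x i)..v (x (Suc i))}"
        have "f (t i) * (v (x (Suc i)) - v (x i)) - integral ?J (\<lambda>y. f (winv v y)) =
            integral ?J (\<lambda>y. f (t i) - f (winv v y))"
          using vv by (subst integral_diff) (auto intro!: int)
        also have "norm \<dots> \<le> \<eta> * measure lborel (cbox (v (x i)) (v (x (Suc i))))"
          unfolding cbox_interval[symmetric]
        \<comment> \<open>The two end values are exempted, since there a flat stretch may move
          \<open>winv v y\<close> out of the cell.\<close>
        proof (rule has_integral_bound_spike_finite[where S = "{v (x i), v (x (Suc i))}"])
          show "((\<lambda>y. f (t i) - f (winv v y)) has_integral
             integral (cbox (v (x i)) (v (x (Suc i)))) (\<lambda>y. f (t i) - f (winv v y)))
             (cbox (v (x i)) (v (x (Suc i))))"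
            by (intro integrable_integral integrable_diff) (auto intro!: int simp: cbox_interval)
          fix y
          assume "y \<in> cbox (v (x i)) (v (x (Suc i))) - {v (x i), v (x (Suc i))}"
          then have y: "v (x i) < y" "y < v (x (Suc i))" by auto
          have xx: "x i \<in> {a..b}" "x (Suc i) \<in> {a..b}" "x i < x (Suc i)"
            "x (Suc i) - x i < \<delta>" "x i \<le> t i" "t i \<le> x (Suc i)"
            using xin[of i] xin[of "Suc i"] i P by auto
          have "x i \<le> winv v y" "winv v y \<le> x (Suc i)"
            using xx y ab by (auto intro!: winv_bounds[of "x i" "x (Suc i)"])
          then show "norm (f (t i) - f (winv v y)) \<le> \<eta>"
            using xx by (intro less_imp_le) (auto intro!: \<delta>(2))
        qed (use \<eta> in auto)
        finally show ?thesis using vv by (simp add: content_real)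
      qed
      have "\<bar>(\<Sum>i<m. f (t i) * (v (x (Suc i)) - v (x i))) - integral {v a..v b} (\<lambda>y. f (winv v y))\<bar> =
          \<bar>\<Sum>i<m. f (t i) * (v (x (Suc i)) - v (x i)) -
             integral {v (x i)..v (x (Suc i))} (\<lambda>y. f (winv v y))\<bar>"
        using split[of m] P by (simp add: sum_subtractf)
      also have "\<dots> \<le> (\<Sum>i<m. \<eta> * (v (x (Suc i)) - v (x i)))"
        by (rule order.trans[OF sum_abs]) (auto intro!: sum_mono piece)
      also have "\<dots> = \<eta> * (v b - v a)"
        using P by (simp add: sum_distrib_left[symmetric] sum_lessThan_telescope[of "\<lambda>i. v (x i)"])
      also have "\<dots> < \<epsilon>"
      proof -
        have "\<eta> * (v b - v a) \<le> \<eta> * (v b - v a + 1)"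
          using \<eta> by (intro mult_left_mono) auto
        also have "\<dots> = \<epsilon> / 2"
          using vab unfolding \<eta>_def by (simp add: divide_simps)
        finally show ?thesis using \<epsilon> by simp
      qed
      finally show "\<bar>(\<Sum>i<m. f (t i) * (v (x (Suc i)) - v (x i))) - integral {v a..v b} (\<lambda>y. f (winv v y))\<bar> < \<epsilon>" .
    qed
  qed
qed

end

section \<open>Gap series of controlled growth\<close>

text \<open>The summand is 2 to the power \<open>- \<bar>i - j\<bar>\<close>. Each new index adds a
  diagonal 1 and two off-diagonal geometric sums, each at most 1.\<close>

lemma sum_power_min_kernel:
  "(\<Sum>i<n. \<Sum>j<n. 4 ^ min i j / (2 ^ i * 2 ^ j)) \<le> 3 * real n"
proof (induction n)
  case (Suc n)
  have "(\<Sum>j<n. (4::real) ^ min n j / (2 ^ n * 2 ^ j)) = (\<Sum>j<n. 2 ^ j) / 2 ^ n"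
    unfolding sum_divide_distrib
  proof (rule sum.cong[OF refl])
    fix j assume "j \<in> {..<n}"
    then have "min n j = j" by simp
    moreover have "(4::real) ^ j = 2 ^ j * 2 ^ j" by (simp add: power_mult_distrib[symmetric])
    ultimately show "(4::real) ^ min n j / (2 ^ n * 2 ^ j) = 2 ^ j / 2 ^ n" by simp
  qed
  also have "(\<Sum>j<n. (2::real) ^ j) = 2 ^ n - 1"
    by (induction n) auto
  also have "(2 ^ n - 1) / 2 ^ n \<le> (1::real)"
    by simp
  finally have *: "(\<Sum>j<n. (4::real) ^ min n j / (2 ^ n * 2 ^ j)) \<le> 1" .
  have "(\<Sum>i<Suc n. \<Sum>j<Suc n. (4::real) ^ min i j / (2 ^ i * 2 ^ j)) =
      (\<Sum>i<n. \<Sum>j<n. 4 ^ min i j / (2 ^ i * 2 ^ j)) +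
      2 * (\<Sum>j<n. 4 ^ min n j / (2 ^ n * 2 ^ j)) + 1"
    by (simp add: sum.distrib min.commute mult.commute power_mult_distrib[symmetric])
  then show ?case using Suc * by simp
qed simp

locale gap_harmonic =
  fixes v :: "real \<Rightarrow> real" and c :: "nat \<Rightarrow> complex" and n :: "nat \<Rightarrow> nat" and D K lam :: real
  assumes weight: "weight v" and doubling: "doubling v D"
    and n_pos: "\<And>k. n k > 0" and ratio: "\<And>k. real (n (Suc k)) \<ge> lam * real (n k)"
    and lam: "lam > 1" and K: "K > 0"
    and summable: "\<And>z. norm z < 1 \<Longrightarrow> summable (\<lambda>k. c k * z ^ n k)"
    and bound: "\<And>z. norm z < 1 \<Longrightarrow> \<bar>gap_series c n z\<bar> \<le> K * v (norm z)"
begin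

abbreviation w :: "real \<Rightarrow> real" where "w \<equiv> winv v"

definition u :: "real \<Rightarrow> real \<Rightarrow> real" where "u \<phi> r = gap_series c n (of_real r * cis \<phi>)"

lemma strict_mono_n: "strict_mono n"
proof (rule strict_monoI_Suc)
  fix k
  have "1 * real (n k) < lam * real (n k)"
    using lam n_pos[of k] by (intro mult_strict_right_mono) auto
  then show "n k < n (Suc k)" using ratio[of k] by linarith
qed

lemma D_ge_1: "D \<ge> 1"
proof -
  have "v (1 - 1/2) \<le> D * v (1 - 2 * (1/2))"
    using doubling unfolding doubling_def by (intro bspec[of _ _ "1/2"]) auto
  moreover have "v 0 = 1" using weight by (simp add: weight_def)
  ultimately show ?thesis using weight_ge_1[OF weight, of "1/2"] by simp
qed

lemma abs_summable:
  assumes "0 \<le> r" "r < 1"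
  shows "summable (\<lambda>k. cmod (c k) * r ^ n k)"
proof -
  define s where "s = (1 + r) / 2"
  have s: "r < s" "s < 1" "s > 0" using assms by (auto simp: s_def)
  have "(\<lambda>k. c k * of_real s ^ n k) \<longlonglongrightarrow> 0"
    using summable[of "of_real s"] s by (intro summable_LIMSEQ_zero) auto
  then have "Bseq (\<lambda>k. c k * of_real s ^ n k)"
    by (intro convergent_imp_Bseq convergentI)
  then obtain B where B: "\<And>k. norm (c k * of_real s ^ n k) \<le> B"
    by (auto simp: Bseq_def)
  show ?thesis
  proof (rule summable_comparison_test')
    show "summable (\<lambda>k. B * (r / s) ^ k)"
      using s assms by (intro summable_mult summable_geometric) auto
    fix k :: nat
    have "cmod (c k) * r ^ n k = norm (c k * of_real s ^ n k) * (r / s) ^ n k"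
      using s by (simp add: norm_mult norm_power power_divide)
    also have "\<dots> \<le> B * (r / s) ^ k"
      \<comment> \<open>Strict monotonicity gives \<open>n k \<ge> k\<close>, hence comparison with
        a geometric series.\<close>
      using s assms B B[THEN order.trans[OF norm_ge_zero]] strict_mono_imp_increasing[OF strict_mono_n, of k]
      by (intro mult_mono power_decreasing) auto
    finally show "norm (cmod (c k) * r ^ n k) \<le> B * (r / s) ^ k"
      using assms by simp
  qed
qed

text \<open>Polar form of the terms. The phase \<open>Arg (c k)\<close> does not involve
  \<open>r\<close>, so radial integration acts on the amplitudes only.\<close>

lemma u_eq:
  assumes "\<bar>r\<bar> < 1"
  shows "(\<lambda>k. cmod (c k) * r ^ n k * cos (real (n k) * \<phi> + Arg (c k))) sums u \<phi> r"
proof -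
  have "(\<lambda>k. c k * (of_real r * cis \<phi>) ^ n k) sums (\<Sum>k. c k * (of_real r * cis \<phi>) ^ n k)"
    using assms by (intro summable_sums summable) (simp add: norm_mult)
  then have "(\<lambda>k. Re (c k * (of_real r * cis \<phi>) ^ n k)) sums u \<phi> r"
    unfolding u_def gap_series_def by (rule sums_Re)
  moreover have "Re (c k * (of_real r * cis \<phi>) ^ n k) =
      cmod (c k) * r ^ n k * cos (real (n k) * \<phi> + Arg (c k))" for k
  proof -
    have "c k * (of_real r * cis \<phi>) ^ n k =
        of_real (cmod (c k)) * cis (Arg (c k)) * (of_real (r ^ n k) * cis (real (n k) * \<phi>))"
      using rcis_cmod_Arg[of "c k"] by (simp add: rcis_def power_mult_distrib Complex.DeMoivre)
    also have "\<dots> = of_real (cmod (c k) * r ^ n k) * cis (real (n k) * \<phi> + Arg (c k))"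
      by (simp add: cis_mult[symmetric] mult_ac)
    finally show ?thesis by (simp add: mult_ac)
  qed
  ultimately show ?thesis by simp
qed

lemma u_bound:
  assumes "0 \<le> r" "r < 1"
  shows "\<bar>u \<phi> r\<bar> \<le> K * v r"
  using bound[of "of_real r * cis \<phi>"] assms by (simp add: u_def norm_mult)

lemma u_cont: "continuous_on {0..<1} (u \<phi>)"
proof (rule continuous_at_imp_continuous_on, rule ballI)
  fix x :: real
  assume x: "x \<in> {0..<1}"
  define t where "t = (1 + x) / 2"
  have t: "x < t" "t < 1" "t > 0" using x by (auto simp: t_def)
  let ?f = "\<lambda>k r. cmod (c k) * r ^ n k * cos (real (n k) * \<phi> + Arg (c k))"
  \<comment> \<open>The interval is symmetric so that \<open>x = 0\<close> is an interior point as
    well.\<close>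
  have "uniform_limit {-t..t} (\<lambda>N r. \<Sum>k<N. ?f k r) (\<lambda>r. \<Sum>k. ?f k r) sequentially"
  proof (rule Weierstrass_m_test)
    show "summable (\<lambda>k. cmod (c k) * t ^ n k)"
      using t by (intro abs_summable) auto
    fix k r assume "r \<in> {-t..t}"
    then have "\<bar>r\<bar> ^ n k \<le> t ^ n k" by (intro power_mono) auto
    then have "cmod (c k) * (\<bar>r\<bar> ^ n k) * \<bar>cos (real (n k) * \<phi> + Arg (c k))\<bar> \<le> cmod (c k) * t ^ n k * 1"
      using t by (intro mult_mono) auto
    then show "norm (?f k r) \<le> cmod (c k) * t ^ n k"
      by (simp add: abs_mult power_abs)
  qed
  then have cont: "continuous_on {-t..t} (\<lambda>r. \<Sum>k. ?f k r)"
    by (rule uniform_limit_theorem[rotated]) (auto intro!: always_eventually continuous_intros)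
  have "continuous_on {-t..t} (\<lambda>r. \<Sum>k. ?f k r) \<longleftrightarrow> continuous_on {-t..t} (u \<phi>)"
    using t by (intro continuous_on_cong refl sums_unique[symmetric] u_eq) auto
  with cont show "isCont (u \<phi>) x"
    using x t by (intro continuous_on_interior) auto
qed

lemma square_sum_bound:
  assumes "0 \<le> r" "r < 1"
  shows "(\<Sum>k<N. (cmod (c k))\<^sup>2 * r ^ (2 * n k)) \<le> 2 * K\<^sup>2 * (v r)\<^sup>2"
proof -
  have "(\<Sum>k<N. (cmod (c k) * r ^ n k)\<^sup>2) \<le> 2 * (K * v r)\<^sup>2"
  proof (rule Bessel_gap[OF strict_mono_n n_pos])
    show "summable (\<lambda>k. \<bar>cmod (c k) * r ^ n k\<bar>)"
      using abs_summable assms by simp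
    show "\<bar>\<Sum>k. cmod (c k) * r ^ n k * cos (real (n k) * \<phi> + Arg (c k))\<bar> \<le> K * v r" for \<phi>
      using sums_unique[OF u_eq[of r \<phi>]] u_bound[OF assms, of \<phi>] assms by simp
  qed
  then show ?thesis
    by (simp add: power_mult_distrib power_mult[symmetric] mult.commute[of _ 2])
qed

text \<open>With \<open>t = sqrt (r * s)\<close> one has
  \<open>2 * t - 1 \<le> t\<^sup>2 \<le> r\<close>, so doubling the distance of \<open>t\<close>
  from 1 already leads to \<open>r\<close> or below. One application of doubling suffices, uniformly
  in \<open>s\<close>.\<close>

lemma v_geometric_mean:
  assumes "0 \<le> r" "r \<le> s" "s < 1"
  shows "v (sqrt (r * s)) \<le> D * v r"
proof -
  let ?t = "sqrt (r * s)"
  have rs: "r * s < 1" "0 \<le> r * s" "r * s \<le> r"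
    using assms mult_left_le[of s r] by auto
  have t: "0 \<le> ?t" "?t < 1" "?t\<^sup>2 \<le> r"
    using rs by auto
  show ?thesis
  proof (cases "?t \<ge> 1/2")
    case True
    have "v (1 - (1 - ?t)) \<le> D * v (1 - 2 * (1 - ?t))"
      using doubling True t unfolding doubling_def by (intro bspec[of _ _ "1 - ?t"]) auto
    also have "\<dots> \<le> D * v r"
    proof (intro mult_left_mono weight_mono[OF weight])
      have "0 \<le> (?t - 1)\<^sup>2" by simp
      then show "1 - 2 * (1 - ?t) \<le> r" using t(3) by (simp add: power2_eq_square algebra_simps)
    qed (use True D_ge_1 assms in auto)
    finally show ?thesis by simp
  next
    \<comment> \<open>Here \<open>1 - ?t\<close> exceeds 1/2 and is outside the range of the
      doubling condition; its endpoint 1/2 is used instead.\<close>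
    case False
    then have "v ?t \<le> v (1 - 1/2)"
      using t by (intro weight_mono[OF weight]) auto
    also have "\<dots> \<le> D * v (1 - 2 * (1/2))"
      using doubling unfolding doubling_def by (intro bspec[of _ _ "1/2"]) auto
    also have "\<dots> \<le> D * v r"
      using weight_ge_1[OF weight, of r] assms D_ge_1 weight by (simp add: weight_def)
    finally show ?thesis .
  qed
qed

section \<open>The integral over the values of \<open>v\<close> as a lacunary series in the
  angle\<close>

text \<open>The denominator is \<open>v (w t)\<close> rather than \<open>t\<close>: the two agree
  for \<open>t \<ge> 1\<close>, and the composed form is integrable on every interval without side
  conditions.\<close>

definition J :: "real \<Rightarrow> real \<Rightarrow> real \<Rightarrow> real" where
  "J x y \<phi> = integral {x..y} (\<lambda>t. u \<phi> (w t) / (v (w t))\<^sup>2)"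

definition \<beta> :: "real \<Rightarrow> real \<Rightarrow> nat \<Rightarrow> real" where
  "\<beta> x y k = integral {x..y} (\<lambda>t. w t ^ n k / (v (w t))\<^sup>2)"

lemma v_pos: "0 \<le> r \<Longrightarrow> r < 1 \<Longrightarrow> v r > 0"
  using weight_ge_1[OF weight, of r] by simp

lemma v_cont: "continuous_on {0..<1} v"
  using weight by (simp add: weight_def)

lemma quotient_cont: "continuous_on {0..<1} f \<Longrightarrow> continuous_on {0..<1} (\<lambda>r. f r / (v r)\<^sup>2)"
  using v_pos by (intro continuous_intros v_cont) fastforce+

lemma J_integrable: "(\<lambda>t. u \<phi> (w t) / (v (w t))\<^sup>2) integrable_on {x..y}"
  by (rule winv_compose_integrable[OF weight quotient_cont[OF u_cont]])

lemma \<beta>_integrable: "(\<lambda>t. w t ^ n k / (v (w t))\<^sup>2) integrable_on {x..y}"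
  by (rule winv_compose_integrable[OF weight quotient_cont]) (intro continuous_intros)

lemma J_combine: "x \<le> y \<Longrightarrow> y \<le> z \<Longrightarrow> J x y \<phi> + J y z \<phi> = J x z \<phi>"
  unfolding J_def by (intro Henstock_Kurzweil_Integration.integral_combine J_integrable)

lemma \<beta>_combine: "x \<le> y \<Longrightarrow> y \<le> z \<Longrightarrow> \<beta> x y k + \<beta> y z k = \<beta> x z k"
  unfolding \<beta>_def by (intro Henstock_Kurzweil_Integration.integral_combine \<beta>_integrable)

lemma I_u_eq:
  assumes "1/2 < R" "R < 1"
  shows "I_u (gap_series c n) v R \<phi> = J (v (1/2)) (v R) \<phi>"
  unfolding I_u_def J_def u_def[symmetric]
  using assms by (intro RS_integral_weight[OF weight quotient_cont[OF u_cont]]) auto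

text \<open>No cancellation is used: the integrand is at most \<open>K / t\<close>. This handles the
  incomplete last block and the initial segment.\<close>

lemma J_bound:
  assumes "1 \<le> x" "x \<le> y"
  shows "\<bar>J x y \<phi>\<bar> \<le> K * (y - x) / x"
proof -
  have "norm (J x y \<phi>) \<le> integral {x..y} (\<lambda>t. K / x)"
    unfolding J_def
  proof (rule integral_norm_bound_integral)
    fix t assume t: "t \<in> {x..y}"
    then have "v (w t) = t" using assms by (intro v_winv[OF weight]) auto
    moreover have "\<bar>u \<phi> (w t)\<bar> \<le> K * v (w t)"
      by (intro u_bound winv_nonneg[OF weight] winv_less_1[OF weight])
    ultimately have "norm (u \<phi> (w t) / (v (w t))\<^sup>2) \<le> K * t / t\<^sup>2"
      by (simp add: divide_right_mono)
    also have "\<dots> = K / t" using t assms by (simp add: power2_eq_square)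
    also have "\<dots> \<le> K / x" using t assms K by (intro divide_left_mono) auto
    finally show "norm (u \<phi> (w t) / (v (w t))\<^sup>2) \<le> K / x" .
  qed (auto intro: J_integrable)
  then show ?thesis using assms by (simp add: field_simps)
qed

lemma \<beta>_nonneg: "\<beta> x y k \<ge> 0"
  unfolding \<beta>_def using winv_nonneg[OF weight] by (intro integral_nonneg \<beta>_integrable) auto

lemma \<beta>_le:
  assumes "1 \<le> x" "x \<le> y"
  shows "\<beta> x y k \<le> w y ^ n k * ((y - x) / x\<^sup>2)"
proof -
  have "\<beta> x y k \<le> integral {x..y} (\<lambda>t. w y ^ n k / x\<^sup>2)"
    unfolding \<beta>_def
  proof (rule integral_le[OF \<beta>_integrable])
    fix t assume t: "t \<in> {x..y}"
    then have "v (w t) = t" using assms by (intro v_winv[OF weight]) auto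
    then show "w t ^ n k / (v (w t))\<^sup>2 \<le> w y ^ n k / x\<^sup>2"
      using t assms winv_nonneg[OF weight] monoD[OF mono_winv[OF weight], of t y]
      by (intro frac_le power_mono) auto
  qed auto
  then show ?thesis using assms by (simp add: field_simps)
qed

lemma \<beta>_summable:
  assumes "1 \<le> x" "x \<le> y"
  shows "summable (\<lambda>k. \<bar>cmod (c k) * \<beta> x y k\<bar>)"
proof (rule summable_comparison_test')
  show "summable (\<lambda>k. cmod (c k) * w y ^ n k * ((y - x) / x\<^sup>2))"
    by (intro summable_mult2 abs_summable winv_nonneg[OF weight] winv_less_1[OF weight])
  show "norm \<bar>cmod (c k) * \<beta> x y k\<bar> \<le> cmod (c k) * w y ^ n k * ((y - x) / x\<^sup>2)" for k
    using mult_left_mono[OF \<beta>_le[OF assms, of k], of "cmod (c k)"] \<beta>_nonneg[of x y k]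
    by (simp add: mult.assoc)
qed

text \<open>Dominated convergence on \<open>{x..y}\<close>: since \<open>w\<close> is monotone and
  \<open>w y < 1\<close>, the constant \<open>(\<Sum>k. cmod (c k) * w y ^ n k)\<close> dominates
  all partial sums.\<close>

lemma J_series:
  assumes "1 \<le> x" "x \<le> y"
  shows "(\<lambda>k. cmod (c k) * \<beta> x y k * cos (real (n k) * \<phi> + Arg (c k))) sums J x y \<phi>"
proof -
  let ?C = "\<lambda>k. cos (real (n k) * \<phi> + Arg (c k))"
  let ?g = "\<lambda>k t. cmod (c k) * w t ^ n k * ?C k / (v (w t))\<^sup>2"
  have sm: "summable (\<lambda>k. cmod (c k) * w y ^ n k)"
    by (intro abs_summable winv_nonneg[OF weight] winv_less_1[OF weight])
  have int: "?g k integrable_on {x..y}" for k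
    using integrable_on_cmult_left[OF \<beta>_integrable[of k x y], of "cmod (c k) * ?C k"]
    by (simp add: mult_ac)
  have "(\<lambda>N. integral {x..y} (\<lambda>t. \<Sum>k<N. ?g k t)) \<longlonglongrightarrow> J x y \<phi>"
    unfolding J_def
  proof (rule dominated_convergence(2)[where h = "\<lambda>_. \<Sum>k. cmod (c k) * w y ^ n k"])
    show "(\<lambda>t. \<Sum>k<N. ?g k t) integrable_on {x..y}" for N
      by (intro integrable_sum int) auto
    fix t assume t: "t \<in> {x..y}"
    have wt: "0 \<le> w t" "w t < 1" "w t \<le> w y"
      using t winv_nonneg[OF weight] winv_less_1[OF weight] monoD[OF mono_winv[OF weight], of t y] by auto
    have v1: "v (w t) \<ge> 1" using wt by (intro weight_ge_1[OF weight])
    have g_le: "\<bar>?g k t\<bar> \<le> cmod (c k) * w y ^ n k" for k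
    proof -
      have "cmod (c k) * w t ^ n k * \<bar>?C k\<bar> / (v (w t))\<^sup>2 \<le> cmod (c k) * w y ^ n k * 1 / 1"
        using wt v1 by (intro frac_le mult_mono power_mono) auto
      then show ?thesis using wt by (simp add: abs_mult)
    qed
    show "norm (\<Sum>k<N. ?g k t) \<le> (\<Sum>k. cmod (c k) * w y ^ n k)" for N
    proof -
      have "norm (\<Sum>k<N. ?g k t) \<le> (\<Sum>k<N. cmod (c k) * w y ^ n k)"
        by (rule sum_norm_le) (use g_le in auto)
      also have "\<dots> \<le> (\<Sum>k. cmod (c k) * w y ^ n k)"
        using winv_nonneg[OF weight] by (intro sum_le_suminf sm) auto
      finally show ?thesis .
    qed
    have "(\<lambda>k. ?g k t) sums (u \<phi> (w t) / (v (w t))\<^sup>2)"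
      using wt by (intro sums_divide u_eq) auto
    then show "(\<lambda>N. \<Sum>k<N. ?g k t) \<longlonglongrightarrow> u \<phi> (w t) / (v (w t))\<^sup>2"
      by (simp add: sums_def)
  qed auto
  moreover have "integral {x..y} (\<lambda>t. \<Sum>k<N. ?g k t) = (\<Sum>k<N. cmod (c k) * \<beta> x y k * ?C k)" for N
  proof -
    have "integral {x..y} (?g k) = cmod (c k) * \<beta> x y k * ?C k" for k
      using integral_mult_right[of "{x..y}" "cmod (c k) * ?C k" "\<lambda>t. w t ^ n k / (v (w t))\<^sup>2"]
      by (simp add: \<beta>_def mult_ac)
    then show ?thesis by (subst integral_sum) (auto intro: int)
  qed
  ultimately show ?thesis by (simp add: sums_def)
qed

text \<open>Near-orthogonality of the dyadic blocks: by Parseval at the radius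
  \<open>sqrt (w (2 ^ (i + 1)) * w (2 ^ (j + 1)))\<close> and by doubling, blocks \<open>i\<close> and \<open>j\<close>
  have a covariance of order \<open>2 ^ (- \<bar>i - j\<bar>)\<close>.\<close>
lemma variance_bound:
  assumes "l \<le> m"
  shows "(\<Sum>k<N. (cmod (c k) * \<beta> (2 ^ l) (2 ^ m) k)\<^sup>2) \<le> 24 * K\<^sup>2 * D\<^sup>2 * (real m - real l)"
proof -
  define \<rho> where "\<rho> i = w (2 ^ (l + i + 1))" for i
  have \<rho>: "0 \<le> \<rho> i" "\<rho> i < 1" for i
    unfolding \<rho>_def using winv_nonneg[OF weight] winv_less_1[OF weight] by auto
  have \<rho>_mono: "\<rho> i \<le> \<rho> j" if "i \<le> j" for i j
    unfolding \<rho>_def using that by (intro monoD[OF mono_winv[OF weight]] power_increasing) auto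
  have v\<rho>: "v (\<rho> i) = 2 ^ (l + i + 1)" for i
    unfolding \<rho>_def by (intro v_winv[OF weight]) (rule one_le_power, simp)
  \<comment> \<open>On one block the amplitude is at most its largest power of the radius times the
    length \<open>2 ^ (l + i)\<close> over the squared lower endpoint.\<close>
  have le: "\<beta> (2 ^ l) (2 ^ (l + d)) k \<le> (\<Sum>i<d. \<rho> i ^ n k / 2 ^ (l + i))" for k d
  proof (induction d)
    case 0
    then show ?case by (simp add: \<beta>_def)
  next
    case (Suc d)
    have "\<beta> (2 ^ l) (2 ^ (l + Suc d)) k = \<beta> (2 ^ l) (2 ^ (l + d)) k + \<beta> (2 ^ (l + d)) (2 ^ (l + d + 1)) k"
      by (subst \<beta>_combine) (auto intro: power_increasing)
    also have "\<beta> (2 ^ (l + d)) (2 ^ (l + d + 1)) k \<le>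
        w (2 ^ (l + d + 1)) ^ n k * ((2 ^ (l + d + 1) - 2 ^ (l + d)) / (2 ^ (l + d))\<^sup>2)"
      by (rule \<beta>_le) (auto intro: one_le_power power_increasing)
    also have "\<dots> = \<rho> d ^ n k / 2 ^ (l + d)"
      by (simp add: \<rho>_def power2_eq_square)
    finally show ?case using Suc by simp
  qed
  \<comment> \<open>The 8 is the Parseval factor 2 times 4, from
    \<open>v (\<rho> i) = 2 * 2 ^ (l + i)\<close> squared; the kernel sum later contributes 3, which
    makes 24.\<close>
  have pair: "(\<Sum>k<N. (cmod (c k))\<^sup>2 * (\<rho> i * \<rho> j) ^ n k) \<le> 8 * K\<^sup>2 * D\<^sup>2 * 4 ^ (l + min i j)" for i j
  proof -
    have *: "(\<Sum>k<N. (cmod (c k))\<^sup>2 * (\<rho> i * \<rho> j) ^ n k) \<le> 8 * K\<^sup>2 * D\<^sup>2 * 4 ^ (l + i)" if "i \<le> j" for i j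
    proof -
      let ?t = "sqrt (\<rho> i * \<rho> j)"
      have "\<rho> i * \<rho> j < 1"
        using \<rho>[of i] \<rho>[of j] mult_left_le[of "\<rho> j" "\<rho> i"] by linarith
      then have t: "0 \<le> ?t" "?t < 1" using \<rho>[of i] \<rho>[of j] by auto
      have "(\<Sum>k<N. (cmod (c k))\<^sup>2 * (\<rho> i * \<rho> j) ^ n k) = (\<Sum>k<N. (cmod (c k))\<^sup>2 * ?t ^ (2 * n k))"
        using \<rho>[of i] \<rho>[of j] by (simp add: power_mult)
      also have "\<dots> \<le> 2 * K\<^sup>2 * (v ?t)\<^sup>2"
        by (rule square_sum_bound[OF t])
      also have "\<dots> \<le> 2 * K\<^sup>2 * (D * v (\<rho> i))\<^sup>2"
        using v_geometric_mean[of "\<rho> i" "\<rho> j"] \<rho> \<rho>_mono[OF that] v_pos[OF t]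
        by (intro mult_left_mono power_mono) auto
      also have "\<dots> = 8 * K\<^sup>2 * D\<^sup>2 * 4 ^ (l + i)"
      proof -
        have "(4::real) ^ (l + i) = (2 ^ (l + i))\<^sup>2"
          by (simp add: power2_eq_square power_mult_distrib[symmetric])
        then show ?thesis by (simp add: v\<rho> power_mult_distrib)
      qed
      finally show ?thesis .
    qed
    show ?thesis
      using *[of i j] *[of j i] by (cases "i \<le> j") (auto simp: min_def mult.commute)
  qed
  define d where "d = m - l"
  have m: "m = l + d" using assms by (simp add: d_def)
  have "(\<Sum>k<N. (cmod (c k) * \<beta> (2 ^ l) (2 ^ m) k)\<^sup>2) \<le>
      (\<Sum>k<N. (cmod (c k))\<^sup>2 * (\<Sum>i<d. \<rho> i ^ n k / 2 ^ (l + i))\<^sup>2)"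
    unfolding power_mult_distrib m using \<beta>_nonneg
    by (intro sum_mono mult_left_mono power_mono le) auto
  also have "\<dots> = (\<Sum>k<N. \<Sum>i<d. \<Sum>j<d. (cmod (c k))\<^sup>2 * (\<rho> i * \<rho> j) ^ n k / (2 ^ (l + i) * 2 ^ (l + j)))"
    by (simp add: power2_eq_square[of "sum _ _"] sum_product sum_distrib_left power_mult_distrib mult_ac)
  also have "\<dots> = (\<Sum>i<d. \<Sum>j<d. \<Sum>k<N. (cmod (c k))\<^sup>2 * (\<rho> i * \<rho> j) ^ n k / (2 ^ (l + i) * 2 ^ (l + j)))"
    by (subst sum.swap, rule sum.cong[OF refl], rule sum.swap)
  also have "\<dots> \<le> (\<Sum>i<d. \<Sum>j<d. 8 * K\<^sup>2 * D\<^sup>2 * 4 ^ (l + min i j) / (2 ^ (l + i) * 2 ^ (l + j)))"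
    unfolding sum_divide_distrib[symmetric] by (intro sum_mono divide_right_mono pair) auto
  also have "\<dots> = 8 * K\<^sup>2 * D\<^sup>2 * (\<Sum>i<d. \<Sum>j<d. 4 ^ min i j / (2 ^ i * 2 ^ j))"
  proof -
    have "(4::real) ^ l = 2 ^ l * 2 ^ l"
      by (simp add: power_mult_distrib[symmetric])
    then show ?thesis
      by (simp add: sum_distrib_left power_add mult_ac)
  qed
  also have "\<dots> \<le> 8 * K\<^sup>2 * D\<^sup>2 * (3 * real d)"
    by (intro mult_left_mono sum_power_min_kernel) auto
  also have "\<dots> = 24 * K\<^sup>2 * D\<^sup>2 * (real m - real l)"
    by (simp add: m)
  finally show ?thesis .
qed

lemma AE_dyadic_bound:
  assumes q: "lam ^ q \<ge> 2" "q > 0"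
  shows "AE \<phi> in restrict_space lborel {-pi..pi}. \<forall>\<^sub>F j in sequentially. \<forall>m<2^j.
    J 1 (2 ^ m) \<phi> \<le> 32 * (5 * real q * K * D) * sqrt (2 ^ j * ln (real j))"
proof -
  let ?M = "restrict_space lborel {-pi..pi}"
  \<comment> \<open>The square has to dominate
    \<open>24 * (real q)\<^sup>2 * K\<^sup>2 * D\<^sup>2\<close>; 5 is the integer whose square 25
    just exceeds 24.\<close>
  define \<sigma> where "\<sigma> = 5 * real q * K * D"
  have \<sigma>: "\<sigma> > 0" using q K D_ge_1 by (simp add: \<sigma>_def)
  have pow1: "1 \<le> (2::real) ^ m" for m by simp
  have J_sum: "J (2 ^ l) (2 ^ m) = (\<lambda>\<phi>. \<Sum>k. cmod (c k) * \<beta> (2 ^ l) (2 ^ m) k * cos (real (n k) * \<phi> + Arg (c k)))"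
    if "l \<le> m" for l m
    using J_series[of "2 ^ l" "2 ^ m"] that by (auto simp: sums_iff fun_eq_iff power_increasing)
  have "AE \<phi> in ?M. \<forall>\<^sub>F j in sequentially. \<forall>m<2^j.
      J 1 (2 ^ m) \<phi> \<le> J 1 (2 ^ 0) \<phi> + 32 * \<sigma> * sqrt (2 ^ j * ln (real j))"
  proof (rule lil_chaining[OF _ \<sigma>])
    show "J 1 (2 ^ m) \<in> borel_measurable ?M" for m
      using J_sum[of 0 m] by (simp, intro measurable_restrict_space1, measurable)
    show "0 \<le> 2 * pi * exp (1::real)" by simp
    fix l m :: nat and s :: real
    assume lm: "l < m" and s: "s \<ge> 0"
    define V where "V = 24 * K\<^sup>2 * D\<^sup>2 * (real m - real l)"
    have V: "V > 0" using lm K D_ge_1 by (simp add: V_def)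
    have "J 1 (2 ^ m) \<phi> - J 1 (2 ^ l) \<phi> = J (2 ^ l) (2 ^ m) \<phi>" for \<phi>
      using J_combine[of 1 "2 ^ l" "2 ^ m" \<phi>] lm by (simp add: power_increasing)
    then have "emeasure ?M {\<phi>\<in>space ?M. J 1 (2 ^ m) \<phi> - J 1 (2 ^ l) \<phi> > s} =
        emeasure ?M {\<phi>\<in>space ?M. (\<Sum>k. cmod (c k) * \<beta> (2 ^ l) (2 ^ m) k * cos (real (n k) * \<phi> + Arg (c k))) > s}"
      using J_sum[of l m] lm by simp
    also have "\<dots> \<le> ennreal (2 * pi * exp 1 * exp (- s\<^sup>2 / (2 * (real q)\<^sup>2 * V)))"
    proof (rule lacunary_tail[where n = n, OF lam q n_pos ratio _ V _ s])
      show "summable (\<lambda>k. \<bar>cmod (c k) * \<beta> (2 ^ l) (2 ^ m) k\<bar>)"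
        using lm by (intro \<beta>_summable pow1 power_increasing) auto
      show "(\<Sum>k<N. (cmod (c k) * \<beta> (2 ^ l) (2 ^ m) k)\<^sup>2) \<le> V" for N
        unfolding V_def using lm by (intro variance_bound) auto
    qed
    also have "\<dots> \<le> ennreal (2 * pi * exp 1 * exp (- s\<^sup>2 / (2 * \<sigma>\<^sup>2 * (real m - real l))))"
    proof -
      have "(real q)\<^sup>2 * V = 24 * ((real q)\<^sup>2 * K\<^sup>2 * D\<^sup>2 * (real m - real l))"
        by (simp add: V_def)
      also have "\<dots> \<le> 25 * ((real q)\<^sup>2 * K\<^sup>2 * D\<^sup>2 * (real m - real l))"
        using lm by (intro mult_right_mono) auto
      also have "\<dots> = \<sigma>\<^sup>2 * (real m - real l)"
        by (simp add: \<sigma>_def power_mult_distrib)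
      finally have "s\<^sup>2 / (2 * \<sigma>\<^sup>2 * (real m - real l)) \<le> s\<^sup>2 / (2 * (real q)\<^sup>2 * V)"
        using V q lm \<sigma> by (intro divide_left_mono mult_pos_pos) (auto simp: mult.assoc)
      then show ?thesis by (intro ennreal_leI mult_left_mono) auto
    qed
    finally show "emeasure ?M {\<phi>\<in>space ?M. J 1 (2 ^ m) \<phi> - J 1 (2 ^ l) \<phi> > s}
      \<le> ennreal (2 * pi * exp 1 * exp (- s\<^sup>2 / (2 * \<sigma>\<^sup>2 * (real m - real l))))" .
  qed
  moreover have "J 1 (2 ^ 0) \<phi> = 0" for \<phi>
    by (simp add: J_def)
  ultimately show ?thesis by (simp add: \<sigma>_def)
qed

end

section \<open>Back from dyadic scales to the radius\<close>

lemma iterated_log_bound: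
  fixes y :: real
  assumes "j \<ge> 12" "2 ^ (j - 1) \<le> M" "2 ^ M \<le> y"
  shows "2 ^ j * ln (real j) \<le> 8 * (ln y * ln (ln (ln y)))"
proof -
  have ln2: "ln (2::real) \<ge> 1/2" using ln2_ge_two_thirds by simp
  have "real M * (1/2) \<le> real M * ln 2" using ln2 by (intro mult_left_mono) auto
  also have "\<dots> = ln (2 ^ M)" by (simp add: ln_realpow)
  also have "\<dots> \<le> ln y" using assms(3) by (intro ln_mono) (auto intro: less_le_trans[of _ "2 ^ M"])
  finally have "real M \<le> 2 * ln y" by simp
  moreover have "(2::real) ^ (j - 1) \<le> real M"
    using assms(2) of_nat_mono[of "2 ^ (j - 1)" M] by simp
  moreover have "(2::real) ^ (j - 1) = 2 * 2 ^ (j - 2)" "(2::real) ^ j = 2 * 2 ^ (j - 1)"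
    using assms(1) by (simp_all add: power_Suc[symmetric] Suc_diff_Suc numeral_2_eq_2 del: power_Suc)
  ultimately have L: "2 ^ (j - 2) \<le> ln y" "2 ^ j \<le> 4 * ln y" by linarith+
  have L0: "ln y > 0" using L(1) zero_less_power[of "2::real" "j - 2"] by linarith
  \<comment> \<open>Since \<open>ln (ln y)\<close> is only known to be at least
    \<open>(j - 2) * ln 2\<close>, it is compared with \<open>sqrt j\<close> instead of
    \<open>j\<close>; taking logarithms, this costs just a factor 2.\<close>
  have "4 * real j \<le> (real j - 2)\<^sup>2"
  proof -
    have "0 \<le> (real j - 8) * real j" using assms(1) by simp
    then show ?thesis by (simp add: power2_eq_square algebra_simps)
  qed
  then have "sqrt (4 * real j) \<le> real j - 2"
    using assms(1) by (intro real_le_lsqrt) auto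
  then have "sqrt (real j) \<le> (real j - 2) * (1/2)"
    by (simp add: real_sqrt_mult)
  also have "\<dots> \<le> (real j - 2) * ln 2"
    using assms(1) ln2 by (intro mult_left_mono) auto
  also have "\<dots> = ln (2 ^ (j - 2))"
    using assms(1) by (simp add: ln_realpow of_nat_diff)
  also have "\<dots> \<le> ln (ln y)"
    using L(1) by (intro ln_mono) (auto intro: less_le_trans[of _ "2 ^ (j - 2)"])
  finally have "ln (sqrt (real j)) \<le> ln (ln (ln y))"
    using assms(1) by (intro ln_mono) (auto intro: less_le_trans[of _ "sqrt (real j)"])
  then have "ln (real j) \<le> 2 * ln (ln (ln y))"
    using assms(1) by (simp add: ln_sqrt)
  then have "2 ^ j * ln (real j) \<le> (4 * ln y) * (2 * ln (ln (ln y)))"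
    using L L0 assms(1) by (intro mult_mono) auto
  then show ?thesis by simp
qed

text \<open>\<open>M\<close> counts the complete blocks below \<open>y\<close>, and \<open>j\<close>
  is the chaining generation containing \<open>M\<close>. The strict \<open>M < 2 ^ j\<close>
  matches the range of the almost sure bound.\<close>

lemma dyadic_scales:
  fixes y :: real
  assumes "y \<ge> 2 ^ (2 ^ J)"
  obtains M j where "2 ^ M \<le> y" "y < 2 ^ (M + 1)" "2 ^ (j - 1) \<le> M" "M < 2 ^ j" "j > J"
proof -
  have y1: "y \<ge> 1" using assms one_le_power[of "2::real" "2 ^ J"] by linarith
  then have "nat \<lfloor>y\<rfloor> \<ge> 1" by linarith
  then obtain M where M: "2 ^ M \<le> nat \<lfloor>y\<rfloor>" "nat \<lfloor>y\<rfloor> < 2 ^ (M + 1)"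
    using ex_power_ivl1[of 2 "nat \<lfloor>y\<rfloor>"] by auto
  have fl: "real (nat \<lfloor>y\<rfloor>) \<le> y" "y < real (nat \<lfloor>y\<rfloor> + 1)" using y1 by linarith+
  have "(2::real) ^ M = real (2 ^ M)" by simp
  also have "\<dots> \<le> real (nat \<lfloor>y\<rfloor>)" using M(1) by (rule of_nat_mono)
  finally have M1: "2 ^ M \<le> y" using fl by linarith
  have "real (nat \<lfloor>y\<rfloor> + 1) \<le> real (2 ^ (M + 1))" using M(2) by (intro of_nat_mono) simp
  also have "\<dots> = 2 ^ (M + 1)" by simp
  finally have M2: "y < 2 ^ (M + 1)" using fl by linarith
  have "(2::real) ^ (2 ^ J) < 2 ^ (M + 1)" using assms M2 by linarith
  then have "2 ^ J < M + 1" by (rule power_less_imp_less_exp[rotated]) simp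
  then have MJ: "2 ^ J \<le> M" by simp
  then have "M \<ge> 1" using one_le_power[of "2::nat" J] by linarith
  then obtain i where i: "2 ^ i \<le> M" "M < 2 ^ (i + 1)"
    using ex_power_ivl1[of 2 M] by auto
  have "(2::nat) ^ J < 2 ^ (i + 1)" using MJ i by linarith
  then have "J < i + 1" by (rule power_less_imp_less_exp[rotated]) simp
  then show ?thesis using that[of M "i + 1"] M1 M2 i by simp
qed

text \<open>The path from \<open>v (1/2)\<close> to \<open>v R\<close> differs from the one from 1
  to the last dyadic value by two bounded pieces. These depend on \<open>v\<close> but are
  eventually below the denominator, which accounts for the summand 1.\<close>

lemma (in gap_harmonic) Limsup_I_u_le:
  assumes S: "S \<ge> 0" and bnd: "\<forall>\<^sub>F j in sequentially. \<forall>m<2^j. J 1 (2 ^ m) \<phi> \<le> S * sqrt (2 ^ j * ln (real j))"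
  shows "Limsup (at_left 1) (\<lambda>R. ereal (I_u (gap_series c n) v R \<phi> /
           sqrt (ln (v R) * ln (ln (ln (v R)))))) \<le> ereal (3 * S + 1)"
proof (rule Limsup_bounded)
  obtain j0 where j0: "\<And>j m. j \<ge> j0 \<Longrightarrow> m < 2 ^ j \<Longrightarrow> J 1 (2 ^ m) \<phi> \<le> S * sqrt (2 ^ j * ln (real j))"
    using bnd unfolding eventually_sequentially by blast
  define A where "A = K + K * v (1/2)"
  have A: "A \<ge> 1 * 0" using K v_pos[of "1/2"] by (simp add: A_def)
  have lim: "LIM R at_left 1. v R :> at_top" using weight by (simp add: weight_def)
  have lnln: "LIM y at_top. ln (ln (y::real)) :> at_top"
    by (rule filterlim_compose[OF ln_at_top ln_at_top])
  have "LIM y at_top. sqrt (ln y * ln (ln (ln (y::real)))) :> at_top"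
    by (intro filterlim_compose[OF sqrt_at_top] filterlim_at_top_mult_at_top ln_at_top
        filterlim_compose[OF ln_at_top lnln])
  then have "\<forall>\<^sub>F y in at_top. A + 1 \<le> sqrt (ln y * ln (ln (ln (y::real))))"
    by (auto simp: filterlim_at_top)
  from eventually_compose_filterlim[OF this lim]
  have ev1: "\<forall>\<^sub>F R in at_left 1. A + 1 \<le> sqrt (ln (v R) * ln (ln (ln (v R))))" .
  have ev2: "\<forall>\<^sub>F R in at_left 1. 2 ^ (2 ^ max j0 12) \<le> v R"
    using lim unfolding filterlim_at_top by blast
  have ev3: "\<forall>\<^sub>F R in at_left (1::real). R \<in> {1/2<..<1}"
    by (rule eventually_at_left_real) simp
  from ev1 ev2 ev3 show "\<forall>\<^sub>F R in at_left 1. ereal (I_u (gap_series c n) v R \<phi> /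
      sqrt (ln (v R) * ln (ln (ln (v R))))) \<le> ereal (3 * S + 1)"
  proof eventually_elim
    case (elim R)
    define y where "y = v R"
    let ?d = "sqrt (ln y * ln (ln (ln y)))"
    obtain M j where Mj: "2 ^ M \<le> y" "y < 2 ^ (M + 1)" "2 ^ (j - 1) \<le> M" "M < 2 ^ j" "j > max j0 12"
      using dyadic_scales elim(2) unfolding y_def by blast
    have half: "1 \<le> v (1/2)" "v (1/2) \<le> y"
      using elim weight_ge_1[OF weight, of "1/2"] weight_mono[OF weight, of "1/2" R] by (auto simp: y_def)
    have pow1: "1 \<le> (2::real) ^ M" by simp
    have "J (v (1/2)) y \<phi> = J 1 (2 ^ M) \<phi> + J (2 ^ M) y \<phi> - J 1 (v (1/2)) \<phi>"
      using J_combine[of 1 "2 ^ M" y \<phi>] J_combine[of 1 "v (1/2)" y \<phi>] Mj half by simp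
    moreover have "\<bar>J (2 ^ M) y \<phi>\<bar> \<le> K"
    proof -
      have "\<bar>J (2 ^ M) y \<phi>\<bar> \<le> K * (y - 2 ^ M) / 2 ^ M"
        using Mj by (intro J_bound) auto
      also have "\<dots> \<le> K * 2 ^ M / 2 ^ M"
        using Mj K by (intro divide_right_mono mult_left_mono) auto
      finally show ?thesis by simp
    qed
    moreover have "\<bar>J 1 (v (1/2)) \<phi>\<bar> \<le> K * v (1/2)"
    proof -
      have "\<bar>J 1 (v (1/2)) \<phi>\<bar> \<le> K * (v (1/2) - 1) / 1"
        using half by (intro J_bound) auto
      also have "\<dots> \<le> K * v (1/2)" using K by simp
      finally show ?thesis .
    qed
    moreover have "J 1 (2 ^ M) \<phi> \<le> S * (3 * ?d)"
    proof -
      have "J 1 (2 ^ M) \<phi> \<le> S * sqrt (2 ^ j * ln (real j))"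
        using Mj by (intro j0) auto
      \<comment> \<open>Rounding 8 up to 9 makes the square root the integer 3.\<close>
      also have "sqrt (2 ^ j * ln (real j)) \<le> sqrt (9 * (ln y * ln (ln (ln y))))"
      proof (rule real_sqrt_le_mono)
        have "2 ^ j * ln (real j) \<le> 8 * (ln y * ln (ln (ln y)))"
          using Mj by (intro iterated_log_bound[of j M]) auto
        moreover have "0 \<le> 2 ^ j * ln (real j)"
          using Mj by simp
        ultimately show "2 ^ j * ln (real j) \<le> 9 * (ln y * ln (ln (ln y)))"
          by linarith
      qed
      also have "\<dots> = 3 * ?d" by (simp add: real_sqrt_mult)
      finally show ?thesis using S by (simp add: mult_left_mono)
    qed
    ultimately have "I_u (gap_series c n) v R \<phi> \<le> 3 * S * ?d + A"
      using I_u_eq[of R \<phi>] elim by (simp add: A_def y_def)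
    also have "\<dots> \<le> (3 * S + 1) * ?d"
      using elim by (simp add: y_def algebra_simps)
    finally have "I_u (gap_series c n) v R \<phi> \<le> (3 * S + 1) * ?d" .
    moreover have "?d > 0" using elim(1) A by (simp only: y_def)
    ultimately have "I_u (gap_series c n) v R \<phi> / ?d \<le> 3 * S + 1"
      by (simp only: pos_divide_le_eq)
    then show ?case by (simp only: y_def ereal_less_eq)
  qed
qed

theorem theorem10:
  fixes D K lam :: real
  assumes "lam > 1" and "K > 0"
  shows "\<exists>C::real. \<forall>(v::real \<Rightarrow> real) (c::nat \<Rightarrow> complex) (n::nat \<Rightarrow> nat).
    weight v \<and> doubling v D \<and>
    (\<forall>k. n k > 0 \<and> real (n (Suc k)) \<ge> lam * real (n k)) \<and>
    (\<forall>z. norm z < 1 \<longrightarrow> summable (\<lambda>k. c k * z ^ n k)) \<and>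
    (\<forall>z. norm z < 1 \<longrightarrow> \<bar>gap_series c n z\<bar> \<le> K * v (norm z))
    \<longrightarrow> (AE \<phi> in lborel. \<phi> \<in> {-pi<..pi} \<longrightarrow>
          Limsup (at_left 1) (\<lambda>R. ereal (I_u (gap_series c n) v R \<phi> /
              sqrt (ln (v R) * ln (ln (ln (v R)))))) \<le> ereal C)"
proof -
  \<comment> \<open>The exponent \<open>q\<close> depends on \<open>lam\<close> alone, so
    \<open>S\<close> is fixed before \<open>v\<close>, \<open>c\<close> and \<open>n\<close> are
    introduced.\<close>
  obtain q where q: "2 \<le> lam ^ q"
    using real_arch_pow[OF assms(1), of 2] less_imp_le by blast
  have q0: "q > 0" using q by (cases q) auto
  define S where "S = 32 * (5 * real q * K * D)"
  show ?thesis
  proof (intro exI[of _ "3 * S + 1"] allI impI)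
    fix v :: "real \<Rightarrow> real" and c :: "nat \<Rightarrow> complex" and n :: "nat \<Rightarrow> nat"
    assume H: "weight v \<and> doubling v D \<and>
      (\<forall>k. n k > 0 \<and> real (n (Suc k)) \<ge> lam * real (n k)) \<and>
      (\<forall>z. norm z < 1 \<longrightarrow> summable (\<lambda>k. c k * z ^ n k)) \<and>
      (\<forall>z. norm z < 1 \<longrightarrow> \<bar>gap_series c n z\<bar> \<le> K * v (norm z))"
    interpret gap_harmonic v c n D K lam
      by unfold_locales (use H assms in auto)
    \<comment> \<open>The sign of \<open>D\<close> is known only now: a weight satisfying the
      doubling condition forces \<open>D \<ge> 1\<close>.\<close>
    have S: "S \<ge> 0" using assms D_ge_1 by (simp add: S_def)
    have "AE \<phi> in lborel. \<phi> \<in> {-pi..pi} \<longrightarrow>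
        (\<forall>\<^sub>F j in sequentially. \<forall>m<2^j. J 1 (2 ^ m) \<phi> \<le> S * sqrt (2 ^ j * ln (real j)))"
      using AE_dyadic_bound[OF q q0] by (simp add: AE_restrict_space_iff S_def)
    then show "AE \<phi> in lborel. \<phi> \<in> {-pi<..pi} \<longrightarrow>
          Limsup (at_left 1) (\<lambda>R. ereal (I_u (gap_series c n) v R \<phi> /
              sqrt (ln (v R) * ln (ln (ln (v R)))))) \<le> ereal (3 * S + 1)"
    proof eventually_elim
      case (elim \<phi>)
      then show ?case
        by (intro impI Limsup_I_u_le[OF S]) auto
    qed
  qed
qed

end
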